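(* Let $\mathcal M=(\Omega,\mathcal F,\mu)$ be a measure space and $H$ a norming $k$-hypergraph pair of Type I with parameter $1$. Let $p_0,p_1\ge1$, $0\le\theta\le1$, and $\frac1p=\frac{1-\theta}{p_0}+\frac{\theta}{p_1}$. Then, with equality of norms, $$[L_{p_0H}(\mathcal M),L_{p_1H}(\mathcal M)]_\theta=L_{pH}(\mathcal M).$$
   Context: A $k$-hypergraph pair $H=(\alpha,\beta)$ consists of finite nonempty sets $V_1,\dots,V_k$ and functions $\alpha,\beta:V\to\mathbb{R}$, where $V=V_1\times\cdots\times V_k$; its size is $|H|=\sum_{\omega\in V}(|\alpha(\omega)|+|\beta(\omega)|)$. All measures are positive. For a measure space $\mathcal M=(\Omega,\mathcal F,\mu)$, the space $\Omega^{V_1}\times\cdots\times\Omega^{V_k}$ (points $x=(x_{i,v})_{i\in[k],v\in V_i}$) carries the product measure, and each $\omega=(\omega_1,\dots,\omega_k)\in V$ defines the projection $\omega(x)=(x_{1,\omega_1},\dots,x_{k,\omega_k})\in\Omega^k$. For measurable $f:\Omega^k\to\mathbb C$, $f^H(x)=\prod_{\omega\in V} f(\omega(x))^{\alpha(\omega)}\,\overline{f(\omega(x))^{\beta(\omega)}}$, with the convention $0^0=1$ (non-integer complex powers taken with a fixed branch). When $\alpha,\beta\ge 0$, set $\|f\|_H=(\int f^H)^{1/|H|}$, and let $L_H(\mathcal M)$ be the set of measurable $f$ with $\|\,|f|\,\|_H<\infty$. $H$ (with $\alpha,\beta\ge0$) is called norming (resp. semi-norming) if $\|\cdot\|_H$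 is a norm (resp. semi-norm) on $L_H(\mathcal M)$ for every measure space $\mathcal M$. $H$ is of Type I with parameter $s$ if $s\ge1$ and $\alpha(\psi)=\beta(\psi)=s/2$ for every $\psi\in{\rm supp}(\alpha)\cup{\rm supp}(\beta)$. For $r\in\mathbb R$, $rH:=(r\alpha,r\beta)$. $[X_0,X_1]_\theta$ denotes the (Calderón) complex interpolation space of a compatible pair of normed spaces, with its interpolation norm. *)

theory Defs
  imports "HOL-Probability.Probability"
begin

text \<open>A k-hypergraph pair: k, the finite nonempty vertex classes V_i (i < k, i.e. [k] is
  indexed by 0..k-1), and alpha, beta on V = V_0 x ... x V_(k-1), where elements of V are
  represented as extensional functions in PiE {..<k} V.\<close>

record 'v hgpair =
  hk :: nat
  hV :: "nat \<Rightarrow> 'v set"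
  halpha :: "(nat \<Rightarrow> 'v) \<Rightarrow> real"
  hbeta :: "(nat \<Rightarrow> 'v) \<Rightarrow> real"

definition hverts :: "'v hgpair \<Rightarrow> (nat \<Rightarrow> 'v) set" where
  "hverts H = PiE {..<hk H} (hV H)"

definition hgpair_wf :: "'v hgpair \<Rightarrow> bool" where
  "hgpair_wf H \<longleftrightarrow> 0 < hk H \<and> (\<forall>i<hk H. finite (hV H i) \<and> hV H i \<noteq> {})"

definition hsize :: "'v hgpair \<Rightarrow> real" where
  "hsize H = (\<Sum>\<omega>\<in>hverts H. \<bar>halpha H \<omega>\<bar> + \<bar>hbeta H \<omega>\<bar>)"

definition hscale :: "real \<Rightarrow> 'v hgpair \<Rightarrow> 'v hgpair" where
  "hscale r H = H\<lparr>halpha := (\<lambda>\<omega>. r * halpha H \<omega>), hbeta := (\<lambda>\<omega>. r * hbeta H \<omega>)\<rparr>"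

definition hnonneg :: "'v hgpair \<Rightarrow> bool" where
  "hnonneg H \<longleftrightarrow> (\<forall>\<omega>\<in>hverts H. 0 \<le> halpha H \<omega> \<and> 0 \<le> hbeta H \<omega>)"

definition typeI :: "'v hgpair \<Rightarrow> real \<Rightarrow> bool" where
  "typeI H s \<longleftrightarrow> 1 \<le> s \<and>
     (\<forall>\<psi>\<in>hverts H. (halpha H \<psi> \<noteq> 0 \<or> hbeta H \<psi> \<noteq> 0) \<longrightarrow>
        halpha H \<psi> = s / 2 \<and> hbeta H \<psi> = s / 2)"

text \<open>Complex power with the convention 0^0 = 1 (principal branch otherwise).\<close>
definition cpow :: "complex \<Rightarrow> real \<Rightarrow> complex" where
  "cpow z a = (if a = 0 then 1 else z powr (complex_of_real a))"

definition hspace :: "'v hgpair \<Rightarrow> 'a measure \<Rightarrow> (nat \<times> 'v \<Rightarrow> 'a) measure" where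
  "hspace H M = PiM (SIGMA i:{..<hk H}. hV H i) (\<lambda>_. M)"

definition kspace :: "'v hgpair \<Rightarrow> 'a measure \<Rightarrow> (nat \<Rightarrow> 'a) measure" where
  "kspace H M = PiM {..<hk H} (\<lambda>_. M)"

definition hproj :: "'v hgpair \<Rightarrow> (nat \<Rightarrow> 'v) \<Rightarrow> (nat \<times> 'v \<Rightarrow> 'a) \<Rightarrow> (nat \<Rightarrow> 'a)" where
  "hproj H \<omega> x = (\<lambda>i\<in>{..<hk H}. x (i, \<omega> i))"

definition hpow :: "'v hgpair \<Rightarrow> ((nat \<Rightarrow> 'a) \<Rightarrow> complex) \<Rightarrow> (nat \<times> 'v \<Rightarrow> 'a) \<Rightarrow> complex" where
  "hpow H f x = (\<Prod>\<omega>\<in>hverts H.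
      cpow (f (hproj H \<omega> x)) (halpha H \<omega>) * cnj (cpow (f (hproj H \<omega> x)) (hbeta H \<omega>)))"

text \<open>||f||_H = (\<integral> f^H)^(1/|H|) (the integral is real and nonnegative whenever this is a
  (semi)norm; we take its real part).\<close>
definition hnorm :: "'v hgpair \<Rightarrow> 'a measure \<Rightarrow> ((nat \<Rightarrow> 'a) \<Rightarrow> complex) \<Rightarrow> real" where
  "hnorm H M f = (Re (integral\<^sup>L (hspace H M) (hpow H f))) powr (1 / hsize H)"

text \<open>L_H(M): measurable f with || |f| ||_H < \<infinity>, i.e. \<integral> |f|^H < \<infinity>.\<close>
definition LH :: "'v hgpair \<Rightarrow> 'a measure \<Rightarrow> ((nat \<Rightarrow> 'a) \<Rightarrow> complex) set" where
  "LH H M = {f \<in> borel_measurable (kspace H M).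
      (\<integral>\<^sup>+ x. ennreal (cmod (hpow H (\<lambda>y. complex_of_real (cmod (f y))) x)) \<partial>hspace H M) < \<infinity>}"

definition hnorm_on :: "'v hgpair \<Rightarrow> 'a measure \<Rightarrow> bool" where
  "hnorm_on H M \<longleftrightarrow>
     (\<forall>f\<in>LH H M. Im (integral\<^sup>L (hspace H M) (hpow H f)) = 0 \<and>
                  0 \<le> Re (integral\<^sup>L (hspace H M) (hpow H f))) \<and>
     (\<forall>f\<in>LH H M. \<forall>g\<in>LH H M. (\<lambda>x. f x + g x) \<in> LH H M \<and>
         hnorm H M (\<lambda>x. f x + g x) \<le> hnorm H M f + hnorm H M g) \<and>
     (\<forall>f\<in>LH H M. \<forall>c::complex. (\<lambda>x. c * f x) \<in> LH H M \<and>
         hnorm H M (\<lambda>x. c * f x) = cmod c * hnorm H M f) \<and>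
     (\<forall>f\<in>LH H M. hnorm H M f = 0 \<longrightarrow> (AE x in kspace H M. f x = 0))"

definition norming :: "'a itself \<Rightarrow> 'v hgpair \<Rightarrow> bool" where
  "norming _ H \<longleftrightarrow> hnonneg H \<and> (\<forall>M :: 'a measure. hnorm_on H M)"

definition sum_space :: "('b \<Rightarrow> complex) set \<Rightarrow> ('b \<Rightarrow> complex) set \<Rightarrow> ('b \<Rightarrow> complex) set" where
  "sum_space X0 X1 = {g. \<exists>f0\<in>X0. \<exists>f1\<in>X1. g = (\<lambda>x. f0 x + f1 x)}"

definition sum_norm :: "('b \<Rightarrow> complex) set \<Rightarrow> (('b \<Rightarrow> complex) \<Rightarrow> real) \<Rightarrow>
    ('b \<Rightarrow> complex) set \<Rightarrow> (('b \<Rightarrow> complex) \<Rightarrow> real) \<Rightarrow> ('b \<Rightarrow> complex) \<Rightarrow> real" where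
  "sum_norm X0 N0 X1 N1 g =
     Inf {N0 f0 + N1 f1 | f0 f1. f0 \<in> X0 \<and> f1 \<in> X1 \<and> g = (\<lambda>x. f0 x + f1 x)}"

definition strip :: "complex set" where
  "strip = {z. 0 \<le> Re z \<and> Re z \<le> 1}"

text \<open>The class F(X0,X1) (Bergh-Lofstrom, Def. 4.1.1): bounded, continuous on the closed
  strip into X0+X1, analytic in the open strip, boundary values t -> F(j + i t) continuous
  into X_j and tending to 0 as |t| -> \<infinity>.\<close>
definition calderon_adm :: "('b \<Rightarrow> complex) set \<Rightarrow> (('b \<Rightarrow> complex) \<Rightarrow> real) \<Rightarrow>
    ('b \<Rightarrow> complex) set \<Rightarrow> (('b \<Rightarrow> complex) \<Rightarrow> real) \<Rightarrow> (complex \<Rightarrow> 'b \<Rightarrow> complex) \<Rightarrow> bool" where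
  "calderon_adm X0 N0 X1 N1 F \<longleftrightarrow>
     (\<forall>z\<in>strip. F z \<in> sum_space X0 X1) \<and>
     (\<exists>B. \<forall>z\<in>strip. sum_norm X0 N0 X1 N1 (F z) \<le> B) \<and>
     (\<forall>z\<in>strip. ((\<lambda>w. sum_norm X0 N0 X1 N1 (\<lambda>x. F w x - F z x)) \<longlongrightarrow> 0) (at z within strip)) \<and>
     (\<forall>z. 0 < Re z \<and> Re z < 1 \<longrightarrow>
        (\<exists>D\<in>sum_space X0 X1.
           ((\<lambda>w. sum_norm X0 N0 X1 N1 (\<lambda>x. (F w x - F z x) / (w - z) - D x)) \<longlongrightarrow> 0) (at z))) \<and>
     (\<forall>t::real. F (\<i> * of_real t) \<in> X0 \<and> F (1 + \<i> * of_real t) \<in> X1) \<and>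
     (\<forall>t::real. ((\<lambda>s::real. N0 (\<lambda>x. F (\<i> * of_real s) x - F (\<i> * of_real t) x)) \<longlongrightarrow> 0) (at t)) \<and>
     (\<forall>t::real. ((\<lambda>s::real. N1 (\<lambda>x. F (1 + \<i> * of_real s) x - F (1 + \<i> * of_real t) x)) \<longlongrightarrow> 0) (at t)) \<and>
     ((\<lambda>t::real. N0 (F (\<i> * of_real t))) \<longlongrightarrow> 0) at_infinity \<and>
     ((\<lambda>t::real. N1 (F (1 + \<i> * of_real t))) \<longlongrightarrow> 0) at_infinity"

definition calderon_norm :: "(('b \<Rightarrow> complex) \<Rightarrow> real) \<Rightarrow> (('b \<Rightarrow> complex) \<Rightarrow> real) \<Rightarrow>
    (complex \<Rightarrow> 'b \<Rightarrow> complex) \<Rightarrow> real" where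
  "calderon_norm N0 N1 F = max (SUP t::real. N0 (F (\<i> * of_real t))) (SUP t::real. N1 (F (1 + \<i> * of_real t)))"

definition interp_space :: "('b \<Rightarrow> complex) set \<Rightarrow> (('b \<Rightarrow> complex) \<Rightarrow> real) \<Rightarrow>
    ('b \<Rightarrow> complex) set \<Rightarrow> (('b \<Rightarrow> complex) \<Rightarrow> real) \<Rightarrow> real \<Rightarrow> ('b \<Rightarrow> complex) set" where
  "interp_space X0 N0 X1 N1 \<theta> = {F (complex_of_real \<theta>) | F. calderon_adm X0 N0 X1 N1 F}"

definition interp_norm :: "('b \<Rightarrow> complex) set \<Rightarrow> (('b \<Rightarrow> complex) \<Rightarrow> real) \<Rightarrow>
    ('b \<Rightarrow> complex) set \<Rightarrow> (('b \<Rightarrow> complex) \<Rightarrow> real) \<Rightarrow> real \<Rightarrow> ('b \<Rightarrow> complex) \<Rightarrow> real" where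
  "interp_norm X0 N0 X1 N1 \<theta> g =
     Inf {calderon_norm N0 N1 F | F. calderon_adm X0 N0 X1 N1 F \<and> F (complex_of_real \<theta>) = g}"

end

theory Submission
  imports Defs "HOL-Complex_Analysis.Complex_Analysis"
begin

text \<open>For a pair of Type I with parameter 1 and support \<open>S\<close>, the norm of \<open>r H\<close> is
  \<open>\<parallel>f\<parallel> = \<Phi>(|f|^r)^(1/r)\<close> with \<open>\<Phi>(g)^|S| = \<integral> \<Prod>\<omega>\<in>S. g(\<omega>(x)) dx\<close>, and of the norming hypothesis
  only the triangle inequality for \<open>\<Phi>\<close> on nonnegative functions is needed. Every \<open>f\<close> in
  \<open>L_(pH)\<close> is the value at \<open>\<theta>\<close> of the damped family \<open>sgn f |f|^(a z)\<close> with
  \<open>a z = p ((1 - z) / p0 + z / p1)\<close>, which bounds the interpolation norm from above.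

  Conversely, differentiating the triangle inequality at \<open>w = h^p\<close> with \<open>\<Phi> w = 1\<close> gives a measure
  \<open>\<nu>\<close> of mass \<open>|S|\<close> against \<open>w\<close> such that \<open>\<integral> g d\<nu> \<le> |S| \<Phi> g\<close>; hence each
  \<open>L_(rH)\<close> norm dominates the corresponding normalised \<open>L^r(\<nu>)\<close> norm, with equality at \<open>h\<close> for
  \<open>r = p\<close>. The lower bound is then the duality argument of the Riesz-Thorin theorem for \<open>\<nu>\<close>,
  applied to simple functions \<open>h\<close> below \<open>|F \<theta>|\<close> and followed by monotone approximation.\<close>

section \<open>The three lines theorem and elementary inequalities\<close>

text \<open>The triangle inequality is available for \<open>H\<close> alone, so for other
  \<open>r\<close> the expression \<open>nrm r\<close> is handled as a quasi-norm, and no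
  description of the dual of L_(rH) is used. This is why the measure carrying the duality depends on
  the function to be normed: it comes from a supporting functional of the gauge at one point.

  Two obstacles shape the lower bound. The value of an admissible \<open>F\<close> at \<theta> is
  known only to lie in the sum space, so membership in L_(pH) is itself a conclusion and
  integrability of \<open>h powr p\<close> must be obtained for simple minorants. Moreover,
  holomorphy of \<open>F\<close> is measured in the sum norm, so the functionals applied to it must
  be bounded on both spaces at once. When \<open>h\<close> has finitely many values, the z-dependent
  test function is a finite combination of fixed functions with this property, with scalar
  exponentials as coefficients.

  In the upper bound the difficulty is the unbounded factor log |f| in the z-derivative of the
  family; it is absorbed at positive distance from the edges of the strip.\<close>

lemma Re_Im_square: "Re (z^2) = (Re z)^2 - (Im z)^2"
  by (simp add: power2_eq_square)

text \<open>The factor exp (e * z^2) has modulus at most exp (e * (1 - (Im z)^2)) on the strip. It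
  makes a bounded \<phi> negligible on the horizontal sides of a tall rectangle, to which the
  maximum modulus principle applies, and costs a factor exp e on the vertical sides. Letting e tend
  to 0 removes that factor.\<close>

lemma three_lines:
  assumes hol: "\<phi> holomorphic_on {z. 0 < Re z \<and> Re z < 1}"
    and cont: "continuous_on strip \<phi>"
    and bdd: "\<And>z. z \<in> strip \<Longrightarrow> cmod (\<phi> z) \<le> B"
    and left: "\<And>t::real. cmod (\<phi> (\<i> * of_real t)) \<le> C"
    and right: "\<And>t::real. cmod (\<phi> (1 + \<i> * of_real t)) \<le> C"
    and \<xi>: "\<xi> \<in> strip"
  shows "cmod (\<phi> \<xi>) \<le> C"
proof -
  have C0: "0 \<le> C" using left[of 0] norm_ge_zero order_trans by blast
  have B0: "0 \<le> B" using bdd[OF \<xi>] norm_ge_zero order_trans by blast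
  have damped: "cmod (exp (of_real e * \<xi>^2) * \<phi> \<xi>) \<le> C * exp e" if e: "e > 0" for e :: real
  proof -
    let ?g = "\<lambda>z. exp (of_real e * z^2) * \<phi> z"
    have damp: "cmod (?g z) \<le> exp (e * (1 - (Im z)^2)) * cmod (\<phi> z)" if "z \<in> strip" for z
    proof -
      have "(Re z)^2 \<le> 1" using that by (auto simp: strip_def abs_square_le_1)
      then have "exp (e * Re (z^2)) \<le> exp (e * (1 - (Im z)^2))"
        using e by (simp add: Re_Im_square)
      then show ?thesis by (simp add: norm_mult mult_right_mono)
    qed
    have "((\<lambda>R::real. exp (e * (1 - R^2)) * B) \<longlongrightarrow> 0) at_top"
      using e by real_asymp
    then have ev: "eventually (\<lambda>R::real. exp (e * (1 - R^2)) * B < C * exp e + d) at_top" if "d > 0" for d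
      using order_tendstoD(2)[of _ 0 at_top "C * exp e + d"] that C0
      by (simp add: add_nonneg_pos)
    then have "cmod (?g \<xi>) \<le> C * exp e + d" if d: "d > 0" for d
    proof -
      have "eventually (\<lambda>R::real. exp (e * (1 - R^2)) * B < C * exp e + d \<and> R > \<bar>Im \<xi>\<bar>) at_top"
        by (intro eventually_conj ev d eventually_gt_at_top)
      then obtain R :: real where R: "exp (e * (1 - R^2)) * B < C * exp e + d" "R > \<bar>Im \<xi>\<bar>"
        using eventually_happens'[OF trivial_limit_at_top_linorder] by blast
      let ?S = "cbox (Complex 0 (-R)) (Complex 1 R)"
      have int: "interior ?S = box (Complex 0 (-R)) (Complex 1 R)"
        by (rule interior_cbox)
      have S: "?S \<subseteq> strip" by (auto simp: in_cbox_complex_iff strip_def)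
      have fr: "cmod (?g z) \<le> C * exp e + d" if "z \<in> frontier ?S" for z
      proof -
        have z: "z \<in> ?S" "z \<notin> box (Complex 0 (-R)) (Complex 1 R)"
          using that unfolding frontier_def int by auto
        then have zs: "z \<in> strip" using S by blast
        consider "Re z = 0" | "Re z = 1" | "\<bar>Im z\<bar> = R"
          using z R by (force simp: in_cbox_complex_iff in_box_complex_iff)
        then show ?thesis
        proof cases
          case 3
          then have "(Im z)^2 = R^2" by (metis power2_abs)
          then have "cmod (?g z) \<le> exp (e * (1 - R^2)) * B"
            using damp[OF zs] bdd[OF zs] by (smt (verit) exp_ge_zero mult_left_mono)
          then show ?thesis using R by simp
        next
          case 1
          then have "z = \<i> * of_real (Im z)" by (simp add: complex_eq_iff)
          then have "cmod (\<phi> z) \<le> C" using left by metis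
          moreover have "exp (e * (1 - (Im z)^2)) \<le> exp e" using e by simp
          ultimately have "exp (e * (1 - (Im z)^2)) * cmod (\<phi> z) \<le> exp e * C"
            by (intro mult_mono) auto
          then show ?thesis using damp[OF zs] d by (simp add: mult.commute)
        next
          case 2
          then have "z = 1 + \<i> * of_real (Im z)" by (simp add: complex_eq_iff)
          then have "cmod (\<phi> z) \<le> C" using right by metis
          moreover have "exp (e * (1 - (Im z)^2)) \<le> exp e" using e by simp
          ultimately have "exp (e * (1 - (Im z)^2)) * cmod (\<phi> z) \<le> exp e * C"
            by (intro mult_mono) auto
          then show ?thesis using damp[OF zs] d by (simp add: mult.commute)
        qed
      qed
      show ?thesis
      proof (rule maximum_modulus_frontier[of ?g ?S])
        have "?g holomorphic_on {z. 0 < Re z \<and> Re z < 1}"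
          by (intro holomorphic_intros hol)
        then show "?g holomorphic_on interior ?S"
          unfolding int by (rule holomorphic_on_subset) (auto simp: in_box_complex_iff)
        have "continuous_on strip ?g" by (intro continuous_intros cont)
        then show "continuous_on (closure ?S) ?g"
          using continuous_on_subset[OF _ S] by (simp only: closure_closed[OF closed_cbox])
        show "\<xi> \<in> ?S" using R \<xi> by (auto simp: in_cbox_complex_iff strip_def)
      qed (use fr in auto)
    qed
    then show ?thesis by (rule field_le_epsilon)
  qed
  have "((\<lambda>e::real. cmod (exp (of_real e * \<xi>^2) * \<phi> \<xi>)) \<longlongrightarrow> cmod (exp (of_real 0 * \<xi>^2) * \<phi> \<xi>)) (at_right 0)"
    by (intro tendsto_intros)
  moreover have "((\<lambda>e::real. C * exp e) \<longlongrightarrow> C * exp 0) (at_right 0)"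
    by (intro tendsto_intros)
  moreover have "\<forall>\<^sub>F e in at_right (0::real). cmod (exp (of_real e * \<xi>^2) * \<phi> \<xi>) \<le> C * exp e"
    using eventually_at_right_less[of "0::real"] by eventually_elim (rule damped)
  ultimately show ?thesis
    using tendsto_le[of "at_right (0::real)" "\<lambda>e. C * exp e" C "\<lambda>e. cmod (exp (of_real e * \<xi>^2) * \<phi> \<xi>)" "cmod (\<phi> \<xi>)"]
    by simp
qed

text \<open>Both sides of the hypothesis equal a ^ n at t = 0, so comparing difference quotients as
  t decreases to 0 bounds D by the derivative of the right side.\<close>

lemma linear_le_of_pow_le:
  fixes a b D :: real and n :: nat
  assumes "\<And>t. t > 0 \<Longrightarrow> a ^ n + t * D \<le> (a + t * b) ^ n"
  shows "D \<le> n * a ^ (n - 1) * b"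
proof -
  have der: "((\<lambda>t. (a + t * b) ^ n) has_field_derivative (n * a ^ (n - 1) * b)) (at 0)"
    by (auto intro!: derivative_eq_intros)
  have "((\<lambda>t. ((a + t * b) ^ n - (a + 0 * b) ^ n) / (t - 0)) \<longlongrightarrow> n * a ^ (n - 1) * b) (at_right 0)"
    using has_field_derivative_at_within[OF der, of "{0<..}"] unfolding has_field_derivative_iff .
  then show ?thesis
  proof (rule tendsto_lowerbound)
    show "\<forall>\<^sub>F t in at_right 0. D \<le> ((a + t * b) ^ n - (a + 0 * b) ^ n) / (t - 0)"
      using eventually_at_right_less[of "0::real"]
      by eventually_elim (use assms in \<open>simp add: field_simps\<close>)
  qed simp
qed

text \<open>The left side collects the terms of degree 0 and 1 in \<open>g\<close> of the expanded
  product; the terms of higher degree are nonnegative.\<close>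

lemma prod_add_ge:
  fixes w g :: "'i \<Rightarrow> real"
  assumes "finite S" "\<And>i. i \<in> S \<Longrightarrow> 0 \<le> w i" "\<And>i. i \<in> S \<Longrightarrow> 0 \<le> g i"
  shows "(\<Prod>i\<in>S. w i) + (\<Sum>i\<in>S. g i * (\<Prod>j\<in>S - {i}. w j)) \<le> (\<Prod>i\<in>S. w i + g i)"
  using assms
proof (induction S rule: finite_induct)
  case (insert k S)
  have eq: "(\<Prod>j\<in>insert k S - {i}. w j) = w k * (\<Prod>j\<in>S - {i}. w j)" if "i \<in> S" for i
  proof -
    have "insert k S - {i} = insert k (S - {i})" using that insert by auto
    then show ?thesis using insert by simp
  qed
  have IH: "(\<Prod>i\<in>S. w i) + (\<Sum>i\<in>S. g i * (\<Prod>j\<in>S - {i}. w j)) \<le> (\<Prod>i\<in>S. w i + g i)"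
    using insert by auto
  have pos: "0 \<le> (\<Sum>i\<in>S. g i * (\<Prod>j\<in>S - {i}. w j))"
    using insert by (auto intro!: sum_nonneg mult_nonneg_nonneg prod_nonneg)
  have "(\<Sum>i\<in>S. g i * (\<Prod>j\<in>insert k S - {i}. w j)) = w k * (\<Sum>i\<in>S. g i * (\<Prod>j\<in>S - {i}. w j))"
    unfolding sum_distrib_left by (rule sum.cong) (auto simp: eq)
  moreover have "(\<Prod>j\<in>insert k S - {k}. w j) = (\<Prod>j\<in>S. w j)"
    using insert by simp
  ultimately have "(\<Prod>i\<in>insert k S. w i) + (\<Sum>i\<in>insert k S. g i * (\<Prod>j\<in>insert k S - {i}. w j))
      = (w k + g k) * (\<Prod>i\<in>S. w i) + w k * (\<Sum>i\<in>S. g i * (\<Prod>j\<in>S - {i}. w j))"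
    using insert by (simp add: algebra_simps)
  also have "\<dots> \<le> (w k + g k) * (\<Prod>i\<in>S. w i) + (w k + g k) * (\<Sum>i\<in>S. g i * (\<Prod>j\<in>S - {i}. w j))"
    using pos insert by (intro add_left_mono mult_right_mono) auto
  also have "\<dots> \<le> (w k + g k) * (\<Prod>i\<in>S. w i + g i)"
    unfolding distrib_left[symmetric] using insert by (intro mult_left_mono IH) auto
  finally show ?case using insert by simp
qed auto

text \<open>Young's inequality for u and v powr (r - 1) with exponents r and r / (r - 1). Writing
  the inverse of the conjugate exponent as 1 - 1 / r keeps r = 1 inside the statement.\<close>

lemma young_powr:
  fixes u v r :: real
  assumes "1 \<le> r" "0 \<le> u" "0 \<le> v"
  shows "u * v powr (r - 1) \<le> u powr r / r + (1 - 1 / r) * v powr r"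
proof (cases "u = 0 \<or> v = 0")
  case True
  then show ?thesis using assms by auto
next
  case False
  then have uv: "u > 0" "v > 0" using assms by auto
  have "(u powr r) powr (1/r) * (v powr r) powr (1 - 1/r) \<le> 1/r * u powr r + (1 - 1/r) * v powr r"
    using assms uv by (intro Youngs_inequality_0) auto
  moreover have "r * (1 - 1/r) = r - 1" using assms by (simp add: field_simps)
  ultimately show ?thesis using assms uv by (simp add: powr_powr)
qed

lemma powr_norm_add_le:
  fixes a b :: complex
  assumes "0 < q"
  shows "cmod (a + b) powr q \<le> 2 powr q * (cmod a powr q + cmod b powr q)"
proof -
  have "cmod (a + b) powr q \<le> (2 * max (cmod a) (cmod b)) powr q"
    using assms norm_triangle_ineq[of a b] by (intro powr_mono2) auto
  also have "\<dots> = 2 powr q * (max (cmod a) (cmod b)) powr q"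
    by (simp add: powr_mult)
  also have "\<dots> \<le> 2 powr q * (cmod a powr q + cmod b powr q)"
    by (intro mult_left_mono) (auto simp: max_def)
  finally show ?thesis .
qed

section \<open>Norms given by product forms\<close>

text \<open>In the application \<open>N\<close> is the product measure indexed by all pairs (i, v),
  \<open>K\<close> is the k-fold product of the given measure, \<open>S\<close> is the support of
  the pair and \<open>pr\<close> sends \<omega> to the projection x -> \<omega>(x).\<close>

locale tensor_forms =
  fixes N :: "'x measure" and K :: "'y measure" and S :: "'i set" and pr :: "'i \<Rightarrow> 'x \<Rightarrow> 'y"
  assumes finite_S: "finite S" and S_nonempty: "S \<noteq> {}"
    and pr_measurable: "\<And>i. i \<in> S \<Longrightarrow> pr i \<in> measurable N K"
begin

definition tensor :: "('y \<Rightarrow> real) \<Rightarrow> 'x \<Rightarrow> real" where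
  "tensor g x = (\<Prod>i\<in>S. g (pr i x))"

text \<open>This is \<Phi>. The integral has the default value 0 when \<open>tensor g\<close> is not
  integrable, so \<open>gauge\<close> carries information only on \<open>cone\<close>.\<close>

definition gauge :: "('y \<Rightarrow> real) \<Rightarrow> real" where
  "gauge g = (integral\<^sup>L N (tensor g)) powr (1 / card S)"

definition cone :: "('y \<Rightarrow> real) set" where
  "cone = {g \<in> borel_measurable K. (\<forall>y. 0 \<le> g y) \<and> integrable N (tensor g)}"

definition Lsp :: "real \<Rightarrow> ('y \<Rightarrow> complex) set" where
  "Lsp q = {f \<in> borel_measurable K. integrable N (tensor (\<lambda>y. cmod (f y) powr q))}"

definition nrm :: "real \<Rightarrow> ('y \<Rightarrow> complex) \<Rightarrow> real" where
  "nrm q f = gauge (\<lambda>y. cmod (f y) powr q) powr (1 / q)"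

lemma card_S_pos: "0 < card S"
  using finite_S S_nonempty by (simp add: card_gt_0_iff)

lemma measurable_comp_pr:
  "i \<in> S \<Longrightarrow> g \<in> measurable K L \<Longrightarrow> (\<lambda>x. g (pr i x)) \<in> measurable N L"
  using measurable_compose[OF pr_measurable] .

lemma measurable_tensor: "g \<in> borel_measurable K \<Longrightarrow> tensor g \<in> borel_measurable N"
  unfolding tensor_def by (intro borel_measurable_prod measurable_comp_pr)

lemma tensor_nonneg: "(\<And>y. 0 \<le> g y) \<Longrightarrow> 0 \<le> tensor g x"
  unfolding tensor_def by (rule prod_nonneg) blast

lemma tensor_mono: "(\<And>y. 0 \<le> g y) \<Longrightarrow> (\<And>y. g y \<le> h y) \<Longrightarrow> tensor g x \<le> tensor h x"
  unfolding tensor_def by (rule prod_mono) auto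

lemma tensor_scale: "tensor (\<lambda>y. c * g y) x = c ^ card S * tensor g x"
  unfolding tensor_def by (simp add: prod.distrib)

lemma gauge_nonneg [simp]: "0 \<le> gauge g"
  by (simp add: gauge_def)

lemma nrm_nonneg [simp]: "0 \<le> nrm q f"
  by (simp add: nrm_def)

lemma coneD:
  "g \<in> cone \<Longrightarrow> g \<in> borel_measurable K" "g \<in> cone \<Longrightarrow> 0 \<le> g y" "g \<in> cone \<Longrightarrow> integrable N (tensor g)"
  by (auto simp: cone_def)

lemma Lsp_iff: "f \<in> Lsp q \<longleftrightarrow> f \<in> borel_measurable K \<and> (\<lambda>y. cmod (f y) powr q) \<in> cone"
proof -
  have "(\<lambda>y. cmod (f y) powr q) \<in> borel_measurable K" if [measurable]: "f \<in> borel_measurable K"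
    by measurable
  then show ?thesis unfolding Lsp_def cone_def by fastforce
qed

lemma integral_tensor_nonneg: "g \<in> cone \<Longrightarrow> 0 \<le> integral\<^sup>L N (tensor g)"
  by (intro integral_nonneg_AE AE_I2 tensor_nonneg coneD)

lemma gauge_power: "g \<in> cone \<Longrightarrow> gauge g ^ card S = integral\<^sup>L N (tensor g)"
  using card_S_pos integral_tensor_nonneg[of g]
  by (cases "integral\<^sup>L N (tensor g) = 0") (simp_all add: gauge_def powr_power)

lemma cone_mono:
  assumes "h \<in> cone" "g \<in> borel_measurable K" "\<And>y. 0 \<le> g y" "\<And>y. g y \<le> h y"
  shows "g \<in> cone" "gauge g \<le> gauge h"
proof -
  have "integrable N (tensor g)"
  proof (rule Bochner_Integration.integrable_bound[OF coneD(3)[OF assms(1)]])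
    show "AE x in N. norm (tensor g x) \<le> norm (tensor h x)"
      using tensor_mono[of g h] tensor_nonneg[of g] assms by (auto intro!: AE_I2 order_trans[OF _ abs_ge_self])
  qed (rule measurable_tensor[OF assms(2)])
  then show g: "g \<in> cone" using assms by (auto simp: cone_def)
  have "integral\<^sup>L N (tensor g) \<le> integral\<^sup>L N (tensor h)"
    by (intro integral_mono coneD tensor_mono assms g)
  then show "gauge g \<le> gauge h"
    unfolding gauge_def using integral_tensor_nonneg[OF g] by (intro powr_mono2) auto
qed

lemma cone_scale:
  assumes "g \<in> cone" "0 \<le> c"
  shows "(\<lambda>y. c * g y) \<in> cone" "gauge (\<lambda>y. c * g y) = c * gauge g"
proof -
  have eq: "tensor (\<lambda>y. c * g y) = (\<lambda>x. c ^ card S * tensor g x)"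
    by (rule ext) (rule tensor_scale)
  show "(\<lambda>y. c * g y) \<in> cone"
    using assms by (auto simp: cone_def eq)
  have "(c ^ card S) powr (1 / card S) = c"
    using assms card_S_pos by (cases "c = 0") (auto simp: powr_realpow[symmetric] powr_powr)
  then show "gauge (\<lambda>y. c * g y) = c * gauge g"
    unfolding gauge_def eq using assms by (simp add: powr_mult integral_tensor_nonneg)
qed

text \<open>Dominated convergence with majorant \<open>tensor m\<close>: every factor tends to 0,
  and there is at least one factor. The limit is first reduced to sequences, for which dominated
  convergence is available. Continuity and differentiability of the analytic family rest on this
  pointwise criterion.\<close>

lemma gauge_tendsto_0:
  fixes z :: "'z::first_countable_topology"
  assumes m: "m \<in> cone" and G: "\<And>w. G w \<in> borel_measurable K" "\<And>w y. 0 \<le> G w y"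
    and dom: "\<forall>\<^sub>F w in at z within s. \<forall>y. G w y \<le> m y"
    and lim: "\<And>y. ((\<lambda>w. G w y) \<longlongrightarrow> 0) (at z within s)"
  shows "((\<lambda>w. gauge (G w)) \<longlongrightarrow> 0) (at z within s)"
proof -
  have "((\<lambda>w. integral\<^sup>L N (tensor (G w))) \<longlongrightarrow> 0) (at z within s)"
    unfolding tendsto_at_iff_sequentially
  proof (intro allI impI)
    fix X assume X: "\<forall>i. X i \<in> s - {z}" "X \<longlonglongrightarrow> z"
    have filt: "filterlim X (at z within s) sequentially"
      using X by (auto simp: filterlim_at)
    obtain k where k: "\<And>i y. i \<ge> k \<Longrightarrow> G (X i) y \<le> m y"
      using eventually_compose_filterlim[OF dom filt] by (auto simp: eventually_sequentially)
    have "(\<lambda>i. integral\<^sup>L N (tensor (G (X (i + k))))) \<longlonglongrightarrow> integral\<^sup>L N (\<lambda>x. 0::real)"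
    proof (rule integral_dominated_convergence[where w = "tensor m"])
      show "AE x in N. (\<lambda>i. tensor (G (X (i + k))) x) \<longlonglongrightarrow> 0"
      proof (rule AE_I2)
        fix x
        have "(\<lambda>i. \<Prod>j\<in>S. G (X (i + k)) (pr j x)) \<longlonglongrightarrow> (\<Prod>j\<in>S. 0)"
          by (intro tendsto_prod LIMSEQ_ignore_initial_segment filterlim_compose[OF lim filt])
        then show "(\<lambda>i. tensor (G (X (i + k))) x) \<longlonglongrightarrow> 0"
          unfolding tensor_def using card_S_pos by (simp add: zero_power)
      qed
      show "AE x in N. norm (tensor (G (X (i + k))) x) \<le> tensor m x" for i
        using k[of "i + k"] G by (intro AE_I2) (simp add: tensor_nonneg tensor_mono)
    qed (auto intro!: measurable_tensor G coneD[OF m])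
    then have "(\<lambda>i. integral\<^sup>L N (tensor (G (X i)))) \<longlonglongrightarrow> 0"
      by (auto intro: LIMSEQ_offset)
    then show "((\<lambda>w. integral\<^sup>L N (tensor (G w))) \<circ> X) \<longlonglongrightarrow> 0"
      by (simp add: comp_def)
  qed
  then show ?thesis
    unfolding gauge_def using card_S_pos
    by (intro tendsto_zero_powrI[where b = "1 / card S"])
      (auto intro!: always_eventually integral_nonneg_AE tensor_nonneg G)
qed

lemma Lsp_mono:
  assumes "g \<in> Lsp q" "0 < q" "f \<in> borel_measurable K" "\<And>y. cmod (f y) \<le> cmod (g y)"
  shows "f \<in> Lsp q" "nrm q f \<le> nrm q g"
proof -
  have le: "cmod (f y) powr q \<le> cmod (g y) powr q" for y
    using assms by (intro powr_mono2) auto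
  have m: "(\<lambda>y. cmod (f y) powr q) \<in> borel_measurable K"
    using assms(3) by measurable
  note c = cone_mono[OF _ m _ le]
  show "f \<in> Lsp q" using assms c(1) by (auto simp: Lsp_iff)
  show "nrm q f \<le> nrm q g"
    unfolding nrm_def using assms c(2) by (intro powr_mono2) (auto simp: Lsp_iff)
qed

lemma Lsp_scale:
  assumes "f \<in> Lsp q" "0 < q"
  shows "(\<lambda>y. c * f y) \<in> Lsp q" "nrm q (\<lambda>y. c * f y) = cmod c * nrm q f"
proof -
  have eq: "(\<lambda>y. cmod (c * f y) powr q) = (\<lambda>y. (cmod c powr q) * cmod (f y) powr q)"
    by (simp add: norm_mult powr_mult)
  have c: "(\<lambda>y. cmod (f y) powr q) \<in> cone" using assms by (simp add: Lsp_iff)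
  have m: "(\<lambda>y. c * f y) \<in> borel_measurable K" using assms by (auto simp: Lsp_iff)
  then show "(\<lambda>y. c * f y) \<in> Lsp q"
    unfolding Lsp_iff eq using cone_scale[OF c] by auto
  show "nrm q (\<lambda>y. c * f y) = cmod c * nrm q f"
    unfolding nrm_def eq using assms by (subst cone_scale(2)[OF c]) (auto simp: powr_mult powr_powr)
qed

lemma nrm_tendsto_0:
  fixes z :: "'z::first_countable_topology"
  assumes q: "0 < q" and m: "m \<in> Lsp q" and G: "\<And>w. G w \<in> borel_measurable K"
    and dom: "\<forall>\<^sub>F w in at z within s. \<forall>y. cmod (G w y) \<le> cmod (m y)"
    and lim: "\<And>y. ((\<lambda>w. G w y) \<longlongrightarrow> 0) (at z within s)"
  shows "((\<lambda>w. nrm q (G w)) \<longlongrightarrow> 0) (at z within s)"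
proof -
  have "((\<lambda>w. gauge (\<lambda>y. cmod (G w y) powr q)) \<longlongrightarrow> 0) (at z within s)"
  proof (rule gauge_tendsto_0)
    show "(\<lambda>y. cmod (m y) powr q) \<in> cone" using m by (simp add: Lsp_iff)
    show "(\<lambda>y. cmod (G w y) powr q) \<in> borel_measurable K" for w using G[of w] by measurable
    show "\<forall>\<^sub>F w in at z within s. \<forall>y. cmod (G w y) powr q \<le> cmod (m y) powr q"
      using dom by eventually_elim (use q in \<open>auto intro: powr_mono2\<close>)
    show "((\<lambda>w. cmod (G w y) powr q) \<longlongrightarrow> 0) (at z within s)" for y
      using q by (intro tendsto_zero_powrI[where b = q] tendsto_norm_zero lim) auto
  qed auto
  then show ?thesis
    unfolding nrm_def using q by (intro tendsto_zero_powrI[where b = "1 / q"]) auto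
qed

end

section \<open>Consequences of the triangle inequality for the gauge\<close>

locale tensor_norm = tensor_forms +
  assumes cone_add: "g \<in> cone \<Longrightarrow> h \<in> cone \<Longrightarrow> (\<lambda>y. g y + h y) \<in> cone"
    and gauge_add: "g \<in> cone \<Longrightarrow> h \<in> cone \<Longrightarrow> gauge (\<lambda>y. g y + h y) \<le> gauge g + gauge h"
begin

text \<open>The triangle inequality for \<open>gauge\<close> is combined with a pointwise bound that
  costs \<open>2 powr q\<close>. The resulting quasi-triangle inequality is enough for closure under
  sums and for local boundedness of curves in \<open>Lsp q\<close>.\<close>

lemma Lsp_add:
  assumes "f \<in> Lsp q" "g \<in> Lsp q" "0 < q"
  shows "(\<lambda>y. f y + g y) \<in> Lsp q"
    "nrm q (\<lambda>y. f y + g y) \<le> (2 powr q * (nrm q f powr q + nrm q g powr q)) powr (1 / q)"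
proof -
  have c: "(\<lambda>y. cmod (f y) powr q) \<in> cone" "(\<lambda>y. cmod (g y) powr q) \<in> cone"
    using assms by (auto simp: Lsp_iff)
  have [measurable]: "f \<in> borel_measurable K" "g \<in> borel_measurable K"
    using assms by (auto simp: Lsp_iff)
  note s = cone_scale[OF cone_add[OF c], of "2 powr q"]
  have m: "(\<lambda>y. cmod (f y + g y) powr q) \<in> borel_measurable K" by measurable
  note d = cone_mono[OF s(1) m _ powr_norm_add_le[OF assms(3)]]
  show "(\<lambda>y. f y + g y) \<in> Lsp q"
    unfolding Lsp_iff using d(1) by auto
  have g: "nrm q h powr q = gauge (\<lambda>y. cmod (h y) powr q)" for h
    unfolding nrm_def using assms by (simp add: powr_powr)
  have "gauge (\<lambda>y. cmod (f y + g y) powr q) \<le> 2 powr q * (nrm q f powr q + nrm q g powr q)"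
    using d(2) s(2) gauge_add[OF c] unfolding g
    by (smt (verit, best) mult_left_mono powr_ge_zero)
  then show "nrm q (\<lambda>y. f y + g y) \<le> (2 powr q * (nrm q f powr q + nrm q g powr q)) powr (1 / q)"
    unfolding nrm_def[of q "\<lambda>y. f y + g y"] using assms by (intro powr_mono2) auto
qed

lemma Lsp_diff: "f \<in> Lsp q \<Longrightarrow> g \<in> Lsp q \<Longrightarrow> 0 < q \<Longrightarrow> (\<lambda>y. f y - g y) \<in> Lsp q"
  using Lsp_add(1)[of f q "\<lambda>y. - 1 * g y"] Lsp_scale(1)[of g q "- 1"] by simp

text \<open>Differentiate the triangle inequality at \<open>w\<close> in direction \<open>g\<close>.\<close>
lemma tensor_hoelder:
  assumes w: "w \<in> cone" and g: "g \<in> cone"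
  shows "integrable N (\<lambda>x. \<Sum>i\<in>S. g (pr i x) * (\<Prod>j\<in>S - {i}. w (pr j x)))" (is "integrable N ?d")
    and "(\<integral>x. (\<Sum>i\<in>S. g (pr i x) * (\<Prod>j\<in>S - {i}. w (pr j x))) \<partial>N)
      \<le> card S * gauge w ^ (card S - 1) * gauge g"
proof -
  have ge: "tensor w x + t * ?d x \<le> tensor (\<lambda>y. w y + t * g y) x" if "0 \<le> t" for x t
  proof -
    have "t * ?d x = (\<Sum>i\<in>S. (t * g (pr i x)) * (\<Prod>j\<in>S - {i}. w (pr j x)))"
      by (simp add: sum_distrib_left mult.assoc)
    then show ?thesis
      unfolding tensor_def
      using prod_add_ge[of S "\<lambda>i. w (pr i x)" "\<lambda>i. t * g (pr i x)"] that finite_S coneD[OF w] coneD[OF g]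
      by simp
  qed
  have pos: "0 \<le> ?d x" for x
    using coneD[OF w] coneD[OF g] by (intro sum_nonneg mult_nonneg_nonneg prod_nonneg) auto
  have [measurable]: "w \<in> borel_measurable K" "g \<in> borel_measurable K"
    using coneD w g by auto
  have meas: "?d \<in> borel_measurable N"
    by (intro borel_measurable_sum borel_measurable_times borel_measurable_prod measurable_comp_pr) auto
  \<comment> \<open>Taking t = 1, the linear part is dominated by the form of w + g, which is
    integrable because \<open>cone\<close> is closed under sums.\<close>
  show int: "integrable N ?d"
  proof (rule Bochner_Integration.integrable_bound[OF coneD(3)[OF cone_add[OF w g]] meas])
    show "AE x in N. norm (?d x) \<le> norm (tensor (\<lambda>y. w y + g y) x)"
    proof (rule AE_I2)
      fix x
      have "0 \<le> tensor w x" using coneD[OF w] by (intro tensor_nonneg)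
      then show "norm (?d x) \<le> norm (tensor (\<lambda>y. w y + g y) x)"
        using ge[of 1 x] pos[of x] by simp
    qed
  qed
  show "integral\<^sup>L N ?d \<le> card S * gauge w ^ (card S - 1) * gauge g"
  proof (rule linear_le_of_pow_le)
    fix t :: real assume t: "t > 0"
    note tg = cone_scale[OF g, of t]
    have wtg: "(\<lambda>y. w y + t * g y) \<in> cone" using cone_add[OF w tg(1)] t by simp
    have "gauge w ^ card S + t * integral\<^sup>L N ?d = integral\<^sup>L N (\<lambda>x. tensor w x + t * ?d x)"
      using int coneD[OF w] by (simp add: gauge_power[OF w])
    also have "\<dots> \<le> integral\<^sup>L N (tensor (\<lambda>y. w y + t * g y))"
      using int coneD(3)[OF w] coneD(3)[OF wtg] ge[of t] t by (intro integral_mono) auto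
    also have "\<dots> = gauge (\<lambda>y. w y + t * g y) ^ card S"
      by (rule gauge_power[OF wtg, symmetric])
    also have "\<dots> \<le> (gauge w + t * gauge g) ^ card S"
      using gauge_add[OF w tg(1)] tg(2) t by (intro power_mono) auto
    finally show "gauge w ^ card S + t * integral\<^sup>L N ?d \<le> (gauge w + t * gauge g) ^ card S" .
  qed
qed

end

section \<open>The analytic family\<close>

lemma sum_norm_le:
  assumes "f0 \<in> X0" "f1 \<in> X1" "\<And>f. 0 \<le> N0 f" "\<And>f. 0 \<le> N1 f"
  shows "sum_norm X0 N0 X1 N1 (\<lambda>x. f0 x + f1 x) \<le> N0 f0 + N1 f1"
  unfolding sum_norm_def using assms
  by (intro cInf_lower) (auto intro!: bdd_belowI[of _ 0])

lemma sum_norm_nonneg: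
  assumes "g \<in> sum_space X0 X1" "\<And>f. 0 \<le> N0 f" "\<And>f. 0 \<le> N1 f"
  shows "0 \<le> sum_norm X0 N0 X1 N1 g"
  unfolding sum_norm_def using assms by (intro cInf_greatest) (auto simp: sum_space_def)

lemma has_field_derivative_diff_bound:
  fixes q q' :: "complex \<Rightarrow> complex"
  assumes "z \<in> S" "w \<in> S" "convex S" "\<And>u. u \<in> S \<Longrightarrow> (q has_field_derivative q' u) (at u)"
    and "\<And>u. u \<in> S \<Longrightarrow> cmod (q' u) \<le> B"
  shows "cmod (q w - q z) \<le> B * cmod (w - z)"
  using field_differentiable_bound[of S q q' B w z] assms
  by (meson has_field_derivative_at_within)

context tensor_norm
begin

text \<open>Cutting \<open>g\<close> along a fixed measurable set turns a pointwise bound into a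
  decomposition for the sum space. It is applied with \<open>P = big f\<close>, the set where the
  majorant attached to the left edge is the larger one.\<close>

lemma dominated_split:
  assumes "0 < p0" "0 < p1" "f0 \<in> Lsp p0" "f1 \<in> Lsp p1" and P: "Measurable.pred K P"
    and g: "g \<in> borel_measurable K" and dom: "\<And>y. cmod (g y) \<le> cmod (if P y then f0 y else f1 y)"
  shows "(\<lambda>y. if P y then g y else 0) \<in> Lsp p0" "(\<lambda>y. if P y then 0 else g y) \<in> Lsp p1"
    "nrm p0 (\<lambda>y. if P y then g y else 0) \<le> nrm p0 f0" "nrm p1 (\<lambda>y. if P y then 0 else g y) \<le> nrm p1 f1"
proof -
  have m: "(\<lambda>y. if P y then g y else 0) \<in> borel_measurable K" "(\<lambda>y. if P y then 0 else g y) \<in> borel_measurable K"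
    using P g by measurable
  have d: "cmod (if P y then g y else 0) \<le> cmod (f0 y)" "cmod (if P y then 0 else g y) \<le> cmod (f1 y)" for y
    using dom[of y] by auto
  show "(\<lambda>y. if P y then g y else 0) \<in> Lsp p0" "nrm p0 (\<lambda>y. if P y then g y else 0) \<le> nrm p0 f0"
    by (rule Lsp_mono[OF assms(3,1) m(1) d(1)])+
  show "(\<lambda>y. if P y then 0 else g y) \<in> Lsp p1" "nrm p1 (\<lambda>y. if P y then 0 else g y) \<le> nrm p1 f1"
    by (rule Lsp_mono[OF assms(4,2) m(2) d(2)])+
qed

lemma sum_norm_split:
  assumes "0 < p0" "0 < p1" "f0 \<in> Lsp p0" "f1 \<in> Lsp p1" and P: "Measurable.pred K P"
    and g: "g \<in> borel_measurable K" and dom: "\<And>y. cmod (g y) \<le> cmod (if P y then f0 y else f1 y)"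
  shows "g \<in> sum_space (Lsp p0) (Lsp p1)"
    "sum_norm (Lsp p0) (nrm p0) (Lsp p1) (nrm p1) g \<le>
      nrm p0 (\<lambda>y. if P y then g y else 0) + nrm p1 (\<lambda>y. if P y then 0 else g y)"
proof -
  have eq: "g = (\<lambda>y. (if P y then g y else 0) + (if P y then 0 else g y))"
    by auto
  note d = dominated_split[OF assms]
  show "g \<in> sum_space (Lsp p0) (Lsp p1)"
    unfolding sum_space_def using d(1,2) by (intro CollectI bexI[where x="\<lambda>y. if P y then g y else 0"] bexI[where x="\<lambda>y. if P y then 0 else g y"]) (use eq in auto)
  show "sum_norm (Lsp p0) (nrm p0) (Lsp p1) (nrm p1) g \<le>
      nrm p0 (\<lambda>y. if P y then g y else 0) + nrm p1 (\<lambda>y. if P y then 0 else g y)"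
    by (subst eq) (rule sum_norm_le[OF d(1,2)], auto)
qed

text \<open>The same set \<open>P\<close> splits \<open>G w\<close> for every w, so the sum norm is
  at most the sum of two norms, each tending to 0 by dominated convergence.\<close>

lemma sum_norm_tendsto_0:
  fixes z :: "'z::first_countable_topology"
  assumes "0 < p0" "0 < p1" "f0 \<in> Lsp p0" "f1 \<in> Lsp p1" and P: "Measurable.pred K P"
    and G: "\<And>w. G w \<in> borel_measurable K"
    and dom: "\<forall>\<^sub>F w in at z within s. \<forall>y. cmod (G w y) \<le> cmod (if P y then f0 y else f1 y)"
    and lim: "\<And>y. ((\<lambda>w. G w y) \<longlongrightarrow> 0) (at z within s)"
  shows "((\<lambda>w. sum_norm (Lsp p0) (nrm p0) (Lsp p1) (nrm p1) (G w)) \<longlongrightarrow> 0) (at z within s)"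
proof (rule tendsto_sandwich)
  note split = sum_norm_split[OF assms(1-5) G]
  show "\<forall>\<^sub>F w in at z within s. 0 \<le> sum_norm (Lsp p0) (nrm p0) (Lsp p1) (nrm p1) (G w)"
    using dom by eventually_elim (rule sum_norm_nonneg, rule split(1), auto)
  show "\<forall>\<^sub>F w in at z within s. sum_norm (Lsp p0) (nrm p0) (Lsp p1) (nrm p1) (G w) \<le>
      nrm p0 (\<lambda>y. if P y then G w y else 0) + nrm p1 (\<lambda>y. if P y then 0 else G w y)"
    using dom by eventually_elim (rule split(2), auto)
  have m: "(\<lambda>y. if P y then G w y else 0) \<in> borel_measurable K" "(\<lambda>y. if P y then 0 else G w y) \<in> borel_measurable K" for w
    using P G[of w] by measurable
  have "((\<lambda>w. nrm p0 (\<lambda>y. if P y then G w y else 0)) \<longlongrightarrow> 0) (at z within s)"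
  proof (rule nrm_tendsto_0[OF assms(1,3) m(1)])
    show "\<forall>\<^sub>F w in at z within s. \<forall>y. cmod (if P y then G w y else 0) \<le> cmod (f0 y)"
      using dom
    proof eventually_elim
      case (elim w) then show ?case by (smt (verit) norm_ge_zero norm_zero)
    qed
    show "((\<lambda>w. if P y then G w y else 0) \<longlongrightarrow> 0) (at z within s)" for y
      using lim by (cases "P y") auto
  qed
  moreover have "((\<lambda>w. nrm p1 (\<lambda>y. if P y then 0 else G w y)) \<longlongrightarrow> 0) (at z within s)"
  proof (rule nrm_tendsto_0[OF assms(2,4) m(2)])
    show "\<forall>\<^sub>F w in at z within s. \<forall>y. cmod (if P y then 0 else G w y) \<le> cmod (f1 y)"
      using dom
    proof eventually_elim
      case (elim w) then show ?case by (smt (verit) norm_ge_zero norm_zero)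
    qed
    show "((\<lambda>w. if P y then 0 else G w y) \<longlongrightarrow> 0) (at z within s)" for y
      using lim by (cases "P y") auto
  qed
  ultimately show "((\<lambda>w. nrm p0 (\<lambda>y. if P y then G w y else 0) + nrm p1 (\<lambda>y. if P y then 0 else G w y)) \<longlongrightarrow> 0) (at z within s)"
    using tendsto_add by fastforce
qed auto

end

section \<open>The exponent, the damped family and its pointwise bounds\<close>

locale interpolation = tensor_norm +
  fixes p0 p1 p \<theta> :: real
  assumes p0: "1 \<le> p0" and p1: "1 \<le> p1" and \<theta>: "0 \<le> \<theta>" "\<theta> \<le> 1"
    and p_eq: "1 / p = (1 - \<theta>) / p0 + \<theta> / p1"
begin

text \<open>\<open>a0\<close> and \<open>a1\<close> are the values at 0 and 1 of the exponent a z of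
  the overview, which is \<open>expo\<close>. Raising |f| to the power p / p0 turns an element of
  L_(pH) into one of L_(p0 H).\<close>

definition a0 :: real where "a0 = p / p0"
definition a1 :: real where "a1 = p / p1"

definition expo :: "complex \<Rightarrow> complex" where
  "expo z = (1 - z) * of_real a0 + z * of_real a1"

lemma p_pos: "0 < p"
proof -
  have "0 < (1 - \<theta>) / p0 + \<theta> / p1"
    using p0 p1 \<theta> by (cases "\<theta> = 0") (auto intro: add_nonneg_pos)
  then show ?thesis using p_eq by (metis zero_less_divide_1_iff)
qed

lemma a_pos: "0 < a0" "0 < a1"
  using p_pos p0 p1 by (auto simp: a0_def a1_def)

lemma a_theta: "(1 - \<theta>) * a0 + \<theta> * a1 = 1"
proof -
  have "(1 - \<theta>) * a0 + \<theta> * a1 = p * ((1 - \<theta>) / p0 + \<theta> / p1)"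
    by (simp add: a0_def a1_def algebra_simps)
  also have "\<dots> = 1" using p_eq[symmetric] p_pos by simp
  finally show ?thesis .
qed

lemma expo_theta: "expo (of_real \<theta>) = 1"
proof -
  have "expo (of_real \<theta>) = of_real ((1 - \<theta>) * a0 + \<theta> * a1)" by (simp add: expo_def)
  then show ?thesis by (simp only: a_theta of_real_1)
qed

lemma Re_expo: "Re (expo z) = (1 - Re z) * a0 + Re z * a1"
  by (simp add: expo_def)

lemma Re_expo_bounds: "z \<in> strip \<Longrightarrow> 0 \<le> Re (expo z)" "z \<in> strip \<Longrightarrow> Re (expo z) \<le> a0 + a1"
  using a_pos unfolding Re_expo strip_def
  by (auto intro!: add_mono mult_left_le_one_le)

text \<open>The damping factor \<open>exp (e * z^2)\<close> gives decay along vertical lines, and \<open>l\<close>, the logarithm of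
  the norm of \<open>f\<close>, balances the norms of the two boundary values.\<close>
definition phase :: "real \<Rightarrow> real \<Rightarrow> real \<Rightarrow> complex \<Rightarrow> complex" where
  "phase e l L z = of_real e * (z^2 - of_real (\<theta>^2)) + (1 - expo z) * of_real l + expo z * of_real L"

definition phase' :: "real \<Rightarrow> real \<Rightarrow> real \<Rightarrow> complex \<Rightarrow> complex" where
  "phase' e l L z = 2 * of_real e * z + of_real ((a1 - a0) * (L - l))"

lemma has_field_derivative_phase: "(phase e l L has_field_derivative phase' e l L z) (at z)"
  unfolding phase_def[abs_def] phase'_def expo_def
  by (auto intro!: derivative_eq_intros simp: algebra_simps)

lemma Re_phase:
  "Re (phase e l L z) = e * ((Re z)^2 - (Im z)^2 - \<theta>^2) + (1 - Re (expo z)) * l + Re (expo z) * L"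
  by (simp add: phase_def Re_Im_square)

text \<open>A bound on the strip for the part of exp (phase) that does not involve \<open>L\<close>:
  the summand e comes from (Re z)^2 \<le> 1, the rest from |1 - Re (expo z)| \<le> 1 + a0 +
  a1.\<close>

definition maj :: "real \<Rightarrow> real \<Rightarrow> real" where
  "maj e l = exp (e + (1 + a0 + a1) * \<bar>l\<bar>)"

lemma Re_phase_le:
  assumes "z \<in> strip" "0 \<le> e"
  shows "Re (phase e l L z) \<le> e + (1 + a0 + a1) * \<bar>l\<bar> + Re (expo z) * L"
proof -
  have "(Re z)^2 \<le> 1" using assms by (auto simp: strip_def abs_square_le_1)
  then have "(Re z)^2 - (Im z)^2 - \<theta>^2 \<le> 1" by (smt (verit) zero_le_power2)
  then have "e * ((Re z)^2 - (Im z)^2 - \<theta>^2) \<le> e"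
    using assms(2) by (rule mult_left_le)
  moreover have "(1 - Re (expo z)) * l \<le> (1 + a0 + a1) * \<bar>l\<bar>"
  proof -
    have "\<bar>1 - Re (expo z)\<bar> \<le> 1 + a0 + a1" using Re_expo_bounds[OF assms(1)] by auto
    then have "\<bar>1 - Re (expo z)\<bar> * \<bar>l\<bar> \<le> (1 + a0 + a1) * \<bar>l\<bar>" by (intro mult_right_mono) auto
    then show ?thesis by (metis abs_ge_self abs_mult order_trans)
  qed
  ultimately show ?thesis unfolding Re_phase by simp
qed

text \<open>Re (expo z) is a convex combination of \<open>a0\<close> and \<open>a1\<close>, so the
  \<open>L\<close> term is at most the larger of its values on the two edges.\<close>

lemma exp_phase_le:
  assumes "z \<in> strip" "0 \<le> e"
  shows "cmod (exp (phase e l L z)) \<le> maj e l * exp (max (a0 * L) (a1 * L))"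
proof -
  have "Re (expo z) * L = (1 - Re z) * (a0 * L) + Re z * (a1 * L)"
    by (simp add: Re_expo algebra_simps)
  also have "\<dots> \<le> max (a0 * L) (a1 * L)"
    using assms by (intro convex_bound_le) (auto simp: strip_def)
  finally show ?thesis
    using Re_phase_le[OF assms, of l L] by (simp add: maj_def exp_add[symmetric])
qed

text \<open>Differentiation brings down the factor (a1 - a0) * L, unbounded in \<open>L\<close>. At
  distance \<delta> from both edges the exponent stays below its maximum over the edges by at least
  \<delta> * v, where v = |(a1 - a0) * L|, and v * exp (- \<delta> * v) \<le> 1 / \<delta> absorbs
  the factor. So the derivative has the same majorant as the family, up to a constant.\<close>

lemma exp_phase_deriv_le:
  assumes \<delta>: "0 < \<delta>" "\<delta> \<le> Re z" "Re z \<le> 1 - \<delta>" and e: "0 \<le> e" and R: "cmod z \<le> R"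
  shows "cmod (exp (phase e l L z) * phase' e l L z) \<le>
    (2 * e * R + \<bar>(a1 - a0) * l\<bar> + 1 / \<delta>) * maj e l * exp (max (a0 * L) (a1 * L))"
proof -
  let ?v = "\<bar>(a1 - a0) * L\<bar>"
  have z: "z \<in> strip" using \<delta> by (auto simp: strip_def)
  have "Re (expo z) * L + \<delta> * ?v \<le> max (a0 * L) (a1 * L)"
  proof (cases "(a1 - a0) * L \<ge> 0")
    case True
    have "Re (expo z) * L = a1 * L - (1 - Re z) * ((a1 - a0) * L)"
      by (simp add: Re_expo algebra_simps)
    moreover have "\<delta> * ((a1 - a0) * L) \<le> (1 - Re z) * ((a1 - a0) * L)"
      using True \<delta> by (intro mult_right_mono) auto
    ultimately show ?thesis using True by auto
  next
    case False
    have "Re (expo z) * L = a0 * L + Re z * ((a1 - a0) * L)"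
      by (simp add: Re_expo algebra_simps)
    moreover have "Re z * ((a1 - a0) * L) \<le> \<delta> * ((a1 - a0) * L)"
      using False \<delta> by (intro mult_right_mono_neg) auto
    ultimately show ?thesis using False by auto
  qed
  then have "Re (phase e l L z) \<le> e + (1 + a0 + a1) * \<bar>l\<bar> + (max (a0 * L) (a1 * L) - \<delta> * ?v)"
    using Re_phase_le[OF z e, of l L] by linarith
  then have exp: "cmod (exp (phase e l L z)) \<le> maj e l * exp (max (a0 * L) (a1 * L)) * exp (- (\<delta> * ?v))"
    unfolding maj_def exp_add[symmetric] by simp
  have "cmod (phase' e l L z) \<le> cmod (2 * of_real e * z) + cmod (of_real ((a1 - a0) * (L - l)))"
    unfolding phase'_def by (rule norm_triangle_ineq)
  also have "cmod (2 * of_real e * z) \<le> 2 * e * R"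
    using e R by (simp add: norm_mult mult_left_mono)
  also have "cmod (of_real ((a1 - a0) * (L - l))) = \<bar>(a1 - a0) * L - (a1 - a0) * l\<bar>"
    unfolding norm_of_real by (simp add: right_diff_distrib)
  also have "\<dots> \<le> \<bar>(a1 - a0) * l\<bar> + ?v" by simp
  finally have der: "cmod (phase' e l L z) \<le> 2 * e * R + \<bar>(a1 - a0) * l\<bar> + ?v" by simp
  have R0: "0 \<le> R" using R norm_ge_zero order_trans by blast
  have "(2 * e * R + \<bar>(a1 - a0) * l\<bar> + ?v) * exp (- (\<delta> * ?v)) \<le> 2 * e * R + \<bar>(a1 - a0) * l\<bar> + 1 / \<delta>"
  proof -
    have "(2 * e * R + \<bar>(a1 - a0) * l\<bar>) * exp (- (\<delta> * ?v)) \<le> 2 * e * R + \<bar>(a1 - a0) * l\<bar>"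
      using \<delta> e R0 by (intro mult_left_le) auto
    moreover have "?v * exp (- (\<delta> * ?v)) \<le> 1 / \<delta>"
    proof -
      have "\<delta> * ?v \<le> exp (\<delta> * ?v)" using exp_ge_add_one_self[of "\<delta> * ?v"] by linarith
      then have "?v \<le> exp (\<delta> * ?v) / \<delta>" using \<delta> by (simp add: pos_le_divide_eq mult.commute)
      then show ?thesis using \<delta> by (simp add: exp_minus field_simps)
    qed
    ultimately show ?thesis by (simp add: distrib_right)
  qed
  then have "(maj e l * exp (max (a0 * L) (a1 * L))) * ((2 * e * R + \<bar>(a1 - a0) * l\<bar> + ?v) * exp (- (\<delta> * ?v)))
    \<le> (maj e l * exp (max (a0 * L) (a1 * L))) * (2 * e * R + \<bar>(a1 - a0) * l\<bar> + 1 / \<delta>)"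
    by (intro mult_left_mono) (auto simp: maj_def)
  moreover have "cmod (exp (phase e l L z) * phase' e l L z) \<le>
    maj e l * exp (max (a0 * L) (a1 * L)) * exp (- (\<delta> * ?v)) * (2 * e * R + \<bar>(a1 - a0) * l\<bar> + ?v)"
    unfolding norm_mult using exp der by (intro mult_mono) (auto simp: maj_def)
  ultimately show ?thesis by (simp add: ac_simps)
qed

text \<open>Written with exp and ln, the function is entire in z for every y; the factor
  \<open>sgn (f y)\<close> makes it 0 at the zeros of f, where ln has a default value.\<close>

definition fam :: "real \<Rightarrow> real \<Rightarrow> ('b \<Rightarrow> complex) \<Rightarrow> complex \<Rightarrow> 'b \<Rightarrow> complex" where
  "fam e l f z y = sgn (f y) * exp (phase e l (ln (cmod (f y))) z)"

definition fam' :: "real \<Rightarrow> real \<Rightarrow> ('b \<Rightarrow> complex) \<Rightarrow> complex \<Rightarrow> 'b \<Rightarrow> complex" where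
  "fam' e l f z y = sgn (f y) * (exp (phase e l (ln (cmod (f y))) z) * phase' e l (ln (cmod (f y))) z)"

text \<open>The points where the left-edge power of |f| dominates. This set is assigned to L_(p0 H)
  and its complement to L_(p1 H).\<close>

definition big :: "('b \<Rightarrow> complex) \<Rightarrow> 'b \<Rightarrow> bool" where
  "big f y \<longleftrightarrow> cmod (f y) powr a1 \<le> cmod (f y) powr a0"

lemma has_field_derivative_fam:
  "((\<lambda>z. fam e l f z y) has_field_derivative fam' e l f z y) (at z)"
  unfolding fam_def fam'_def
  by (intro DERIV_cmult DERIV_fun_exp has_field_derivative_phase)

text \<open>At \<theta> the damping exponent z^2 - \<theta>^2 vanishes, and expo = 1 removes the
  \<open>l\<close> term as well; this is why both occur in \<open>phase\<close> in this
  form.\<close>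

lemma fam_theta: "fam e l f (of_real \<theta>) = f"
proof
  fix y
  have "phase e l L (of_real \<theta>) = of_real L" for L by (simp add: phase_def expo_theta)
  then show "fam e l f (of_real \<theta>) y = f y"
    by (cases "f y = 0") (auto simp: fam_def sgn_eq exp_of_real)
qed

lemma sgn_exp_max:
  "cmod (sgn (f y)) * exp (max (a0 * ln (cmod (f y))) (a1 * ln (cmod (f y)))) =
    cmod (if big f y then of_real (cmod (f y) powr a0) else of_real (cmod (f y) powr a1))"
  by (auto simp: big_def norm_sgn powr_def max_def)

lemma fam_le:
  assumes "z \<in> strip" "0 \<le> e"
  shows "cmod (fam e l f z y) \<le>
    cmod (if big f y then of_real (maj e l) * of_real (cmod (f y) powr a0) else of_real (maj e l) * of_real (cmod (f y) powr a1))"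
proof -
  have "cmod (fam e l f z y) \<le> cmod (sgn (f y)) * (maj e l * exp (max (a0 * ln (cmod (f y))) (a1 * ln (cmod (f y)))))"
    unfolding fam_def norm_mult by (intro mult_left_mono exp_phase_le assms) auto
  also have "\<dots> = maj e l * cmod (if big f y then of_real (cmod (f y) powr a0) else of_real (cmod (f y) powr a1))"
    unfolding sgn_exp_max[symmetric] by simp
  finally show ?thesis by (auto simp: norm_mult maj_def)
qed

lemma fam'_le:
  assumes "0 < \<delta>" "\<delta> \<le> Re z" "Re z \<le> 1 - \<delta>" "0 \<le> e" "cmod z \<le> R"
    and C: "C = (2 * e * R + \<bar>(a1 - a0) * l\<bar> + 1 / \<delta>) * maj e l"
  shows "cmod (fam' e l f z y) \<le> C *
    cmod (if big f y then of_real (cmod (f y) powr a0) else of_real (cmod (f y) powr a1))"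
proof -
  have "cmod (fam' e l f z y) \<le> cmod (sgn (f y)) * (C * exp (max (a0 * ln (cmod (f y))) (a1 * ln (cmod (f y)))))"
    unfolding fam'_def C norm_mult[of "sgn (f y)"] by (intro mult_left_mono exp_phase_deriv_le assms) auto
  then show ?thesis unfolding sgn_exp_max[symmetric] by (simp add: ac_simps)
qed

lemma measurable_fam:
  assumes [measurable]: "f \<in> borel_measurable K"
  shows "fam e l f z \<in> borel_measurable K" "fam' e l f z \<in> borel_measurable K" "Measurable.pred K (big f)"
  unfolding fam_def[abs_def] fam'_def[abs_def] phase_def phase'_def complex_sgn_def big_def[abs_def]
  by measurable

end

context tensor_forms
begin

lemma Lsp_power:
  assumes "f \<in> Lsp p" "0 < q"
  shows "(\<lambda>y. complex_of_real (cmod (f y) powr (p / q))) \<in> Lsp q"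
    and "0 < p \<Longrightarrow> nrm q (\<lambda>y. complex_of_real (cmod (f y) powr (p / q))) = nrm p f powr (p / q)"
proof -
  have [measurable]: "f \<in> borel_measurable K" using assms by (auto simp: Lsp_iff)
  have eq: "(\<lambda>y. cmod (complex_of_real (cmod (f y) powr (p / q))) powr q) = (\<lambda>y. cmod (f y) powr p)"
    using assms by (simp add: powr_powr)
  have "(\<lambda>y. complex_of_real (cmod (f y) powr (p / q))) \<in> borel_measurable K" by measurable
  then show "(\<lambda>y. complex_of_real (cmod (f y) powr (p / q))) \<in> Lsp q"
    using assms unfolding Lsp_iff eq by simp
  show "nrm q (\<lambda>y. complex_of_real (cmod (f y) powr (p / q))) = nrm p f powr (p / q)" if "0 < p"
    using that assms unfolding nrm_def eq by (simp add: powr_powr)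
qed

end

context interpolation
begin

abbreviation "snorm \<equiv> sum_norm (Lsp p0) (nrm p0) (Lsp p1) (nrm p1)"

lemma pp: "0 < p0" "0 < p1"
  using p0 p1 by auto

lemma cmod_fam_left:
  "cmod (fam e l f (\<i> * of_real t) y) = exp (- e * (t^2 + \<theta>^2) + (1 - a0) * l) * cmod (f y) powr a0"
proof -
  have "Re (expo (\<i> * of_real t)) = a0" by (simp add: Re_expo)
  then show ?thesis
    by (auto simp: fam_def norm_mult norm_sgn Re_phase powr_def exp_add algebra_simps exp_diff)
qed

lemma cmod_fam_right:
  "cmod (fam e l f (1 + \<i> * of_real t) y) = exp (e * (1 - t^2 - \<theta>^2) + (1 - a1) * l) * cmod (f y) powr a1"
proof -
  have "Re (expo (1 + \<i> * of_real t)) = a1" by (simp add: Re_expo)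
  then show ?thesis
    by (auto simp: fam_def norm_mult norm_sgn Re_phase powr_def exp_add algebra_simps exp_diff)
qed

lemma fam_left:
  assumes "f \<in> Lsp p"
  shows "fam e l f (\<i> * of_real t) \<in> Lsp p0"
    "nrm p0 (fam e l f (\<i> * of_real t)) \<le> exp (- e * (t^2 + \<theta>^2) + (1 - a0) * l) * nrm p f powr a0"
proof -
  let ?c = "exp (- e * (t^2 + \<theta>^2) + (1 - a0) * l)"
  note pw = Lsp_power[OF assms pp(1)]
  note sc = Lsp_scale[OF pw(1) pp(1), of "of_real ?c"]
  have "f \<in> borel_measurable K" using assms by (auto simp: Lsp_iff)
  note m = measurable_fam(1)[OF this]
  have "cmod (fam e l f (\<i> * of_real t) y) \<le> cmod (of_real ?c * of_real (cmod (f y) powr (p / p0)))" for y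
    unfolding cmod_fam_left a0_def[symmetric] norm_mult norm_of_real by simp
  note mono = Lsp_mono[OF sc(1) pp(1) m this]
  show "fam e l f (\<i> * of_real t) \<in> Lsp p0" by (rule mono)
  show "nrm p0 (fam e l f (\<i> * of_real t)) \<le> ?c * nrm p f powr a0"
    using mono(2)[unfolded sc(2) pw(2)[OF p_pos] norm_of_real] unfolding a0_def by simp
qed

lemma fam_right:
  assumes "f \<in> Lsp p"
  shows "fam e l f (1 + \<i> * of_real t) \<in> Lsp p1"
    "nrm p1 (fam e l f (1 + \<i> * of_real t)) \<le> exp (e * (1 - t^2 - \<theta>^2) + (1 - a1) * l) * nrm p f powr a1"
proof -
  let ?c = "exp (e * (1 - t^2 - \<theta>^2) + (1 - a1) * l)"
  note pw = Lsp_power[OF assms pp(2)]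
  note sc = Lsp_scale[OF pw(1) pp(2), of "of_real ?c"]
  have "f \<in> borel_measurable K" using assms by (auto simp: Lsp_iff)
  note m = measurable_fam(1)[OF this]
  have "cmod (fam e l f (1 + \<i> * of_real t) y) \<le> cmod (of_real ?c * of_real (cmod (f y) powr (p / p1)))" for y
    unfolding cmod_fam_right a1_def[symmetric] norm_mult norm_of_real by simp
  note mono = Lsp_mono[OF sc(1) pp(2) m this]
  show "fam e l f (1 + \<i> * of_real t) \<in> Lsp p1" by (rule mono)
  show "nrm p1 (fam e l f (1 + \<i> * of_real t)) \<le> ?c * nrm p f powr a1"
    using mono(2)[unfolded sc(2) pw(2)[OF p_pos] norm_of_real] unfolding a1_def by simp
qed

text \<open>Every convergence in the interior and on the edges follows from dominated convergence,
  with a multiple of \<open>u0\<close> on \<open>big f\<close> and of \<open>u1\<close> off it as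
  majorant in the sum space, and a single one of the two on an edge. The strictly positive e
  provides the decay along the edges.\<close>

lemma calderon_adm_fam:
  assumes f: "f \<in> Lsp p" and e: "0 < e"
  shows "calderon_adm (Lsp p0) (nrm p0) (Lsp p1) (nrm p1) (fam e l f)"
proof -
  define u0 u1 where u0_def: "u0 = (\<lambda>y. complex_of_real (cmod (f y) powr (p / p0)))"
    and u1_def: "u1 = (\<lambda>y. complex_of_real (cmod (f y) powr (p / p1)))"
  have u: "u0 \<in> Lsp p0" "u1 \<in> Lsp p1"
    unfolding u0_def u1_def using Lsp_power(1)[OF f] pp by auto
  have fm: "f \<in> borel_measurable K" using f by (auto simp: Lsp_iff)
  note m = measurable_fam[OF fm]
  let ?c = "maj e l"
  have cu: "(\<lambda>y. of_real r * u0 y) \<in> Lsp p0" "(\<lambda>y. of_real r * u1 y) \<in> Lsp p1" for r :: real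
    using Lsp_scale(1) u pp by auto
  have le: "cmod (fam e l f z y) \<le> ?c * cmod (if big f y then u0 y else u1 y)" if "z \<in> strip" for z y
    using fam_le[OF that, of e l f y] e by (auto simp: u0_def u1_def a0_def a1_def norm_mult maj_def)
  have le': "cmod (fam e l f z y) \<le> cmod (if big f y then of_real ?c * u0 y else of_real ?c * u1 y)" if "z \<in> strip" for z y
    using le[OF that, of y] by (auto simp: norm_mult maj_def)
  note split = sum_norm_split[OF pp cu m(3) m(1) le'] dominated_split(3,4)[OF pp cu m(3) m(1) le']
  have adm4: "\<exists>D\<in>sum_space (Lsp p0) (Lsp p1).
      ((\<lambda>w. snorm (\<lambda>x. (fam e l f w x - fam e l f z x) / (w - z) - D x)) \<longlongrightarrow> 0) (at z)"
    if z: "0 < Re z" "Re z < 1" for z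
  proof -
    \<comment> \<open>Half the distance from z to the edges: every point of the closed ball of
      radius \<delta> about z still has distance at least \<delta> from both edges, so the
      derivative bound is uniform there.\<close>
    define \<delta> where "\<delta> = min (Re z) (1 - Re z) / 2"
    have \<delta>: "0 < \<delta>" "2 * \<delta> \<le> Re z" "2 * \<delta> \<le> 1 - Re z" using z by (auto simp: \<delta>_def)
    define C where "C = (2 * e * (cmod z + \<delta>) + \<bar>(a1 - a0) * l\<bar> + 1 / \<delta>) * maj e l"
    have C: "0 \<le> C" using e \<delta> unfolding C_def maj_def
      by (intro mult_nonneg_nonneg add_nonneg_nonneg) auto
    have der: "cmod (fam' e l f w y) \<le> C * cmod (if big f y then u0 y else u1 y)" if "w \<in> cball z \<delta>" for w y
    proof -
      have d: "cmod (w - z) \<le> \<delta>" using that by (simp add: dist_norm norm_minus_commute)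
      then have "\<bar>Re w - Re z\<bar> \<le> \<delta>" using abs_Re_le_cmod[of "w - z"] by simp
      then have "\<delta> \<le> Re w" "Re w \<le> 1 - \<delta>" using \<delta> by linarith+
      moreover have "cmod w \<le> cmod z + \<delta>" using d norm_triangle_ineq[of z "w - z"] by simp
      ultimately show ?thesis
        using fam'_le[OF \<delta>(1) _ _ _ _ C_def, of w f y] e by (auto simp: u0_def u1_def a0_def a1_def split: if_splits)
    qed
    have quot: "cmod ((fam e l f w y - fam e l f z y) / (w - z)) \<le> C * cmod (if big f y then u0 y else u1 y)"
      if "w \<in> cball z \<delta>" for w y
    proof (cases "w = z")
      case False
      have "cmod (fam e l f w y - fam e l f z y) \<le> C * cmod (if big f y then u0 y else u1 y) * cmod (w - z)"
        using \<delta> that der has_field_derivative_fam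
        by (intro has_field_derivative_diff_bound[where S = "cball z \<delta>" and q' = "\<lambda>u. fam' e l f u y"]) auto
      then show ?thesis using False by (simp add: norm_divide divide_le_eq)
    qed (use C in auto)
    \<comment> \<open>The factor 2 * C accounts for the difference quotient and the derivative, each
      bounded by C times the majorant; the former by the mean value inequality on the ball.\<close>
    have diff: "cmod ((fam e l f w y - fam e l f z y) / (w - z) - fam' e l f z y)
        \<le> cmod (if big f y then of_real (2 * C) * u0 y else of_real (2 * C) * u1 y)"
      if "w \<in> cball z \<delta>" for w y
    proof -
      have "z \<in> cball z \<delta>" using \<delta> by simp
      then have "cmod ((fam e l f w y - fam e l f z y) / (w - z) - fam' e l f z y)
        \<le> 2 * (C * cmod (if big f y then u0 y else u1 y))"
        using norm_triangle_ineq4[of "(fam e l f w y - fam e l f z y) / (w - z)" "fam' e l f z y"]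
          quot[OF that, of y] der[of z y] by linarith
      then show ?thesis using C by (auto simp: norm_mult)
    qed
    have D: "fam' e l f z \<in> sum_space (Lsp p0) (Lsp p1)"
    proof (rule sum_norm_split(1)[OF pp cu m(3) m(2)])
      show "cmod (fam' e l f z y) \<le> cmod (if big f y then of_real C * u0 y else of_real C * u1 y)" for y
        using der[of z y] \<delta> C by (auto simp: norm_mult split: if_splits)
    qed
    have "((\<lambda>w. snorm (\<lambda>x. (fam e l f w x - fam e l f z x) / (w - z) - fam' e l f z x)) \<longlongrightarrow> 0) (at z)"
    proof (rule sum_norm_tendsto_0[OF pp cu m(3)])
      show "(\<lambda>x. (fam e l f w x - fam e l f z x) / (w - z) - fam' e l f z x) \<in> borel_measurable K" for w
        using m(1,2) by (intro borel_measurable_diff borel_measurable_divide) auto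
      have "\<forall>\<^sub>F w in at z. w \<in> cball z \<delta>"
        using \<delta>(1) by (auto simp: eventually_at dist_commute intro!: exI[of _ \<delta>])
      then show "\<forall>\<^sub>F w in at z. \<forall>y. cmod ((fam e l f w y - fam e l f z y) / (w - z) - fam' e l f z y)
        \<le> cmod (if big f y then of_real (2 * C) * u0 y else of_real (2 * C) * u1 y)"
        by eventually_elim (use diff in blast)
      show "((\<lambda>w. (fam e l f w y - fam e l f z y) / (w - z) - fam' e l f z y) \<longlongrightarrow> 0) (at z)" for y
        using has_field_derivative_fam[of e l f y z] unfolding has_field_derivative_iff
        by (simp add: LIM_zero_iff)
    qed
    then show ?thesis using D by blast
  qed
  have cont: "((\<lambda>w. fam e l f w y) \<longlongrightarrow> fam e l f z y) (at z within s)" for z s y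
    using DERIV_isCont[OF has_field_derivative_fam] unfolding isCont_def by (rule tendsto_within_subset) simp
  have adm3: "((\<lambda>w. snorm (\<lambda>x. fam e l f w x - fam e l f z x)) \<longlongrightarrow> 0) (at z within strip)"
    if z: "z \<in> strip" for z
  proof (rule sum_norm_tendsto_0[OF pp cu m(3)])
    show "(\<lambda>x. fam e l f w x - fam e l f z x) \<in> borel_measurable K" for w
      using m(1) by (intro borel_measurable_diff) auto
    have "\<forall>\<^sub>F w in at z within strip. w \<in> strip" by (auto simp: eventually_at_filter)
    then show "\<forall>\<^sub>F w in at z within strip. \<forall>y. cmod (fam e l f w y - fam e l f z y)
        \<le> cmod (if big f y then of_real (2 * ?c) * u0 y else of_real (2 * ?c) * u1 y)"
    proof eventually_elim
      case (elim w)
      show ?case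
      proof
        fix y
        have "cmod (fam e l f w y - fam e l f z y) \<le> 2 * (?c * cmod (if big f y then u0 y else u1 y))"
          using norm_triangle_ineq4[of "fam e l f w y" "fam e l f z y"] le[OF z, of y] le[OF elim, of y] by linarith
        then show "cmod (fam e l f w y - fam e l f z y)
          \<le> cmod (if big f y then of_real (2 * ?c) * u0 y else of_real (2 * ?c) * u1 y)"
          by (auto simp: norm_mult maj_def)
      qed
    qed
    show "((\<lambda>w. fam e l f w y - fam e l f z y) \<longlongrightarrow> 0) (at z within strip)" for y
      using cont by (simp add: LIM_zero_iff)
  qed
  have bnd: "((\<lambda>s::real. nrm q (\<lambda>x. fam e l f (g s) x - fam e l f (g t) x)) \<longlongrightarrow> 0) (at t)"
    if q: "0 < q" and ug: "ug \<in> Lsp q" and g: "isCont g t"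
      and bd: "\<And>s y. cmod (fam e l f (g s) y) \<le> cmod (ug y)" for t q ug g
  proof (rule nrm_tendsto_0[OF q])
    show "(\<lambda>y. of_real 2 * ug y) \<in> Lsp q" using Lsp_scale(1)[OF ug q] .
    show "(\<lambda>x. fam e l f (g w) x - fam e l f (g t) x) \<in> borel_measurable K" for w
      using m(1) by (intro borel_measurable_diff) auto
    show "\<forall>\<^sub>F s in at t. \<forall>y. cmod (fam e l f (g s) y - fam e l f (g t) y) \<le> cmod (of_real 2 * ug y)"
    proof (intro always_eventually allI)
      fix s y
      show "cmod (fam e l f (g s) y - fam e l f (g t) y) \<le> cmod (of_real 2 * ug y)"
        using norm_triangle_ineq4[of "fam e l f (g s) y" "fam e l f (g t) y"] bd[of s y] bd[of t y]
        unfolding norm_mult norm_of_real by linarith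
    qed
    have "((\<lambda>s. fam e l f (g s) y) \<longlongrightarrow> fam e l f (g t) y) (at t)" for y
      by (rule isCont_tendsto_compose[where g = "\<lambda>z. fam e l f z y"])
        (use g DERIV_isCont[OF has_field_derivative_fam] in \<open>auto simp: isCont_def\<close>)
    then show "((\<lambda>s. fam e l f (g s) y - fam e l f (g t) y) \<longlongrightarrow> 0) (at t)" for y
      by (simp add: LIM_zero_iff)
  qed
  \<comment> \<open>Bounds uniform in t for the exact constants on the edges: the damping factor is
    at most 1 on the left and at most exp e on the right, where Re (z^2) = 1 - t^2.\<close>
  define k0 k1 where "k0 = exp ((1 - a0) * l)" and "k1 = exp (e + (1 - a1) * l)"
  have le0: "cmod (fam e l f (\<i> * of_real s) y) \<le> cmod (of_real k0 * u0 y)" for s y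
  proof -
    have "exp (- e * (s^2 + \<theta>^2) + (1 - a0) * l) \<le> k0" using e by (simp add: k0_def)
    then show ?thesis
      unfolding cmod_fam_left norm_mult by (intro mult_mono) (auto simp: u0_def a0_def k0_def)
  qed
  have le1: "cmod (fam e l f (1 + \<i> * of_real s) y) \<le> cmod (of_real k1 * u1 y)" for s y
  proof -
    have "e * (1 - s^2 - \<theta>^2) \<le> e" using e by simp
    then have "exp (e * (1 - s^2 - \<theta>^2) + (1 - a1) * l) \<le> k1" by (simp add: k1_def)
    then show ?thesis
      unfolding cmod_fam_right norm_mult by (intro mult_mono) (auto simp: u1_def a1_def k1_def)
  qed
  have dec: "((\<lambda>t::real. exp (- e * (t^2 + \<theta>^2) + (1 - a0) * l) * c) \<longlongrightarrow> 0) at_infinity"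
    "((\<lambda>t::real. exp (e * (1 - t^2 - \<theta>^2) + (1 - a1) * l) * c) \<longlongrightarrow> 0) at_infinity" for c
    unfolding at_infinity_eq_at_top_bot using e by (intro filterlim_sup; real_asymp)+
  have dec0: "((\<lambda>t::real. nrm p0 (fam e l f (\<i> * of_real t))) \<longlongrightarrow> 0) at_infinity"
    by (rule tendsto_sandwich[OF _ _ tendsto_const dec(1)[of "nrm p f powr a0"]])
      (rule always_eventually, use fam_left(2)[OF f, of e l] in simp)+
  have dec1: "((\<lambda>t::real. nrm p1 (fam e l f (1 + \<i> * of_real t))) \<longlongrightarrow> 0) at_infinity"
    by (rule tendsto_sandwich[OF _ _ tendsto_const dec(2)[of "nrm p f powr a1"]])
      (rule always_eventually, use fam_right(2)[OF f, of e l] in simp)+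
  show ?thesis
    unfolding calderon_adm_def
  proof (intro conjI allI ballI)
    show "\<exists>B. \<forall>z\<in>strip. snorm (fam e l f z) \<le> B"
      using split(2-4) by (meson add_mono order_trans)
    show "((\<lambda>s. nrm p0 (\<lambda>x. fam e l f (\<i> * of_real s) x - fam e l f (\<i> * of_real t) x)) \<longlongrightarrow> 0) (at t)" for t
      by (rule bnd[OF pp(1) cu(1)[of k0] _ le0]) (intro continuous_intros)
    show "((\<lambda>s. nrm p1 (\<lambda>x. fam e l f (1 + \<i> * of_real s) x - fam e l f (1 + \<i> * of_real t) x)) \<longlongrightarrow> 0) (at t)" for t
      by (rule bnd[OF pp(2) cu(2)[of k1] _ le1]) (intro continuous_intros)
  qed (use split(1) adm3 adm4 fam_left(1)[OF f] fam_right(1)[OF f] dec0 dec1 in auto)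
qed

text \<open>With l the logarithm of the norm T of f, the edge bounds exp ((1 - a) * l) * T powr a
  both collapse to T; the factor exp e is the price of damping on the right edge.\<close>

lemma calderon_norm_fam:
  assumes f: "f \<in> Lsp p" and e: "0 < e"
  shows "calderon_norm (nrm p0) (nrm p1) (fam e (ln (nrm p f)) f) \<le> exp e * nrm p f"
proof -
  let ?T = "nrm p f"
  \<comment> \<open>If T = 0, ln T is a default value, but T powr a is 0 and the identity
    persists.\<close>
  have eq: "exp ((1 - a) * ln ?T) * ?T powr a = ?T" if "0 < a" for a
  proof (cases "?T = 0")
    case False
    then have "0 < ?T" using nrm_nonneg[of p f] by linarith
    then show ?thesis by (simp add: powr_def exp_add[symmetric] algebra_simps)
  qed simp
  have "nrm p0 (fam e (ln ?T) f (\<i> * of_real t)) \<le> exp e * ?T" for t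
  proof -
    have "nrm p0 (fam e (ln ?T) f (\<i> * of_real t)) \<le> exp (- e * (t^2 + \<theta>^2)) * (exp ((1 - a0) * ln ?T) * ?T powr a0)"
      using fam_left(2)[OF f, of e "ln ?T" t] by (simp only: exp_add mult.assoc)
    also have "\<dots> = exp (- e * (t^2 + \<theta>^2)) * ?T" unfolding eq[OF a_pos(1)] ..
    also have "\<dots> \<le> exp e * ?T" using e by (intro mult_right_mono) (auto intro: order_trans[of _ 0])
    finally show ?thesis .
  qed
  moreover have "nrm p1 (fam e (ln ?T) f (1 + \<i> * of_real t)) \<le> exp e * ?T" for t
  proof -
    have "nrm p1 (fam e (ln ?T) f (1 + \<i> * of_real t)) \<le> exp (e * (1 - t^2 - \<theta>^2)) * (exp ((1 - a1) * ln ?T) * ?T powr a1)"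
      using fam_right(2)[OF f, of e "ln ?T" t] by (simp only: exp_add mult.assoc)
    also have "\<dots> = exp (e * (1 - t^2 - \<theta>^2)) * ?T" unfolding eq[OF a_pos(2)] ..
    also have "\<dots> \<le> exp e * ?T" using e by (intro mult_right_mono) auto
    finally show ?thesis .
  qed
  ultimately show ?thesis
    unfolding calderon_norm_def by (auto intro!: max.boundedI cSUP_least)
qed

end

section \<open>The norming functional\<close>

context tensor_norm
begin

text \<open>Without boundedness the suprema in \<open>calderon_norm\<close> would not be upper
  bounds. The quasi-triangle inequality yields local boundedness of t -> nrm q (G t) directly; the
  decay at infinity leaves a compact interval to be covered.\<close>

lemma nrm_bdd_above:
  fixes G :: "real \<Rightarrow> 'b \<Rightarrow> complex"
  assumes q: "0 < q" and G: "\<And>t. G t \<in> Lsp q"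
    and cont: "\<And>t. ((\<lambda>s. nrm q (\<lambda>x. G s x - G t x)) \<longlongrightarrow> 0) (at t)"
    and lim: "((\<lambda>t. nrm q (G t)) \<longlongrightarrow> 0) at_infinity"
  shows "bdd_above (range (\<lambda>t. nrm q (G t)))"
proof -
  obtain R where R: "\<And>t. R \<le> \<bar>t\<bar> \<Longrightarrow> nrm q (G t) < 1"
    using order_tendstoD(2)[OF lim, of 1] by (auto simp: eventually_at_infinity)
  \<comment> \<open>Bolzano's principle: boundedness passes to unions of adjacent intervals and
    holds on short intervals around each point, hence on every interval.\<close>
  have "\<exists>B. \<forall>s\<in>{a..b}. nrm q (G s) \<le> B" if "a \<le> b" for a b
    using that
  proof (rule Bolzano, goal_cases trans local)
    case (trans a b c)
    from trans(1,2) obtain B1 B2 where "\<forall>s\<in>{a..b}. nrm q (G s) \<le> B1" "\<forall>s\<in>{b..c}. nrm q (G s) \<le> B2" by blast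
    then have "\<forall>s\<in>{a..c}. nrm q (G s) \<le> max B1 B2" by (auto simp: le_max_iff_disj)
    then show ?case by blast
  next
    case (local t)
    obtain d where d: "d > 0" "\<And>s. s \<noteq> t \<Longrightarrow> dist s t < d \<Longrightarrow> nrm q (\<lambda>x. G s x - G t x) < 1"
      using order_tendstoD(2)[OF cont[of t], of 1] by (auto simp: eventually_at)
    let ?B = "max (nrm q (G t)) ((2 powr q * (1 powr q + nrm q (G t) powr q)) powr (1 / q))"
    have B: "nrm q (G s) \<le> ?B" if "dist s t < d" for s
    proof (cases "s = t")
      case False
      have "nrm q (\<lambda>y. (G s y - G t y) + G t y) \<le>
          (2 powr q * (nrm q (\<lambda>y. G s y - G t y) powr q + nrm q (G t) powr q)) powr (1 / q)"
        by (rule Lsp_add(2)[OF Lsp_diff[OF G G q] G q])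
      also have "\<dots> \<le> (2 powr q * (1 powr q + nrm q (G t) powr q)) powr (1 / q)"
        using d(2)[OF False that] q
        by (intro powr_mono2 mult_left_mono add_right_mono) (auto intro!: mult_nonneg_nonneg add_nonneg_nonneg)
      finally show ?thesis by simp
    qed auto
    have "\<forall>s\<in>{a..b}. nrm q (G s) \<le> ?B" if "a \<le> t" "t \<le> b" "b - a < d" for a b
      using that by (intro ballI B) (auto simp: dist_real_def)
    then show ?case using d(1) by blast
  qed
  then obtain B where B: "\<And>s. s \<in> {-\<bar>R\<bar>..\<bar>R\<bar>} \<Longrightarrow> nrm q (G s) \<le> B"
    by (metis abs_ge_zero neg_le_0_iff_le order_trans)
  have "nrm q (G s) \<le> max B 1" for s
  proof (cases "R \<le> \<bar>s\<bar>")
    case True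
    then show ?thesis using R[of s] by simp
  next
    case False
    then have "s \<in> {-\<bar>R\<bar>..\<bar>R\<bar>}" by auto
    then show ?thesis using B[of s] by simp
  qed
  then show ?thesis by (auto intro!: bdd_aboveI)
qed

lemma sum_space_lin:
  assumes "0 < p0" "0 < p1" "f \<in> sum_space (Lsp p0) (Lsp p1)" "g \<in> sum_space (Lsp p0) (Lsp p1)"
  shows "(\<lambda>y. a * f y + b * g y) \<in> sum_space (Lsp p0) (Lsp p1)"
proof -
  obtain f0 f1 g0 g1 where eq: "f = (\<lambda>y. f0 y + f1 y)" "g = (\<lambda>y. g0 y + g1 y)"
    and fg: "f0 \<in> Lsp p0" "f1 \<in> Lsp p1" "g0 \<in> Lsp p0" "g1 \<in> Lsp p1"
    using assms by (auto simp: sum_space_def)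
  have "(\<lambda>y. a * f0 y + b * g0 y) \<in> Lsp p0" "(\<lambda>y. a * f1 y + b * g1 y) \<in> Lsp p1"
    using fg assms by (auto intro!: Lsp_add Lsp_scale)
  then show ?thesis
    unfolding sum_space_def eq
    by (intro CollectI bexI[where x = "\<lambda>y. a * f0 y + b * g0 y"] bexI[where x = "\<lambda>y. a * f1 y + b * g1 y"])
      (auto simp: algebra_simps)
qed

end

text \<open>A functional on the sum space that norms a given weight \<open>h\<close>: the derivative of the gauge at
  \<open>h powr p\<close>.\<close>
locale dual_functional = tensor_norm +
  fixes p :: real and h :: "'b \<Rightarrow> real"
  assumes h_cone: "(\<lambda>y. h y powr p) \<in> cone" and h_meas: "h \<in> borel_measurable K"
    and h_nonneg: "\<And>y. 0 \<le> h y" and h_gauge: "gauge (\<lambda>y. h y powr p) = 1"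
begin

text \<open>The coefficient of the i-th direction in the derivative of the product form at
  \<open>h powr p\<close>.\<close>

definition wt :: "'c \<Rightarrow> 'a \<Rightarrow> real" where
  "wt i x = (\<Prod>j\<in>S - {i}. h (pr j x) powr p)"

definition dens :: "('b \<Rightarrow> complex) \<Rightarrow> ('b \<Rightarrow> complex) \<Rightarrow> 'a \<Rightarrow> complex" where
  "dens m g x = (\<Sum>i\<in>S. m (pr i x) * g (pr i x) * of_real (wt i x))"

text \<open>The integral of m * g against \<nu>. The measure \<nu>, the sum over i of the images
  under \<open>pr i\<close> of \<open>wt i\<close> times \<open>N\<close>, is not formed; its
  integrals are kept on \<open>N\<close>.\<close>

definition lin :: "('b \<Rightarrow> complex) \<Rightarrow> ('b \<Rightarrow> complex) \<Rightarrow> complex" where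
  "lin m g = integral\<^sup>L N (dens m g)"

lemma wt_nonneg: "0 \<le> wt i x"
  by (simp add: wt_def prod_nonneg)

lemma measurable_wt: "wt i \<in> borel_measurable N"
proof -
  have [measurable]: "h \<in> borel_measurable K" by (rule h_meas)
  have "(\<lambda>y. h y powr p) \<in> borel_measurable K" by measurable
  then show ?thesis
    unfolding wt_def[abs_def] by (intro borel_measurable_prod measurable_comp_pr) auto
qed

lemma measurable_dens:
  assumes "m \<in> borel_measurable K" "g \<in> borel_measurable K"
  shows "dens m g \<in> borel_measurable N"
proof -
  have "(\<lambda>x. complex_of_real (wt i x)) \<in> borel_measurable N" for i
    using measurable_wt[of i] by measurable
  then show ?thesis
    unfolding dens_def[abs_def]
    by (intro borel_measurable_sum borel_measurable_times
        measurable_comp_pr[OF _ assms(1)] measurable_comp_pr[OF _ assms(2)])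
qed

lemma sum_wt:
  assumes "g \<in> cone"
  shows "integrable N (\<lambda>x. \<Sum>i\<in>S. g (pr i x) * wt i x)"
    "(\<integral>x. (\<Sum>i\<in>S. g (pr i x) * wt i x) \<partial>N) \<le> card S * gauge g"
  using tensor_hoelder[OF h_cone assms] by (auto simp: h_gauge wt_def)

text \<open>Euler's identity for a form of degree |S|: each summand restores the factor missing from
  \<open>wt i\<close>. Integrated, it gives the mass |S| of \<open>h powr p\<close> against
  \<nu>.\<close>

lemma sum_wt_self:
  "(\<Sum>i\<in>S. h (pr i x) powr p * wt i x) = card S * tensor (\<lambda>y. h y powr p) x"
proof -
  have "h (pr i x) powr p * wt i x = tensor (\<lambda>y. h y powr p) x" if "i \<in> S" for i
    unfolding wt_def tensor_def using that finite_S by (simp add: prod.remove)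
  then show ?thesis by simp
qed

lemma integral_tensor_self: "integral\<^sup>L N (tensor (\<lambda>y. h y powr p)) = 1"
  using gauge_power[OF h_cone] by (simp add: h_gauge)

text \<open>Hoelder's inequality for \<nu> between g in L^q and h powr (p - p / q) in the conjugate
  space, whose norm is fixed by the mass of \<open>h powr p\<close>. It is derived from Young's
  inequality for u / s and v powr (p / q), multiplied by s.\<close>

lemma dual_bound:
  assumes q: "1 \<le> q" and g: "g \<in> Lsp q"
  shows "integrable N (\<lambda>x. \<Sum>i\<in>S. cmod (g (pr i x)) * h (pr i x) powr (p - p / q) * wt i x)" (is "integrable N ?d")
    "integral\<^sup>L N (\<lambda>x. \<Sum>i\<in>S. cmod (g (pr i x)) * h (pr i x) powr (p - p / q) * wt i x) \<le> card S * nrm q g"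
proof -
  have gm: "g \<in> borel_measurable K" and gc: "(\<lambda>y. cmod (g y) powr q) \<in> cone"
    using g by (auto simp: Lsp_iff)
  let ?G = "\<lambda>x. \<Sum>i\<in>S. cmod (g (pr i x)) powr q * wt i x"
  let ?H = "\<lambda>x. card S * tensor (\<lambda>y. h y powr p) x"
  have iG: "integrable N ?G" and iH: "integrable N ?H"
    using sum_wt(1)[OF gc] coneD(3)[OF h_cone] by auto
  have young: "?d x \<le> s powr (1 - q) / q * ?G x + s * (1 - 1 / q) * ?H x" if s: "0 < s" for s x
  proof -
    have pt: "u * v powr (p - p / q) \<le> s powr (1 - q) / q * u powr q + s * (1 - 1 / q) * v powr p"
      if "0 \<le> u" "0 \<le> v" for u v :: real
    proof -
      have "u / s * (v powr (p / q)) powr (q - 1) \<le> (u / s) powr q / q + (1 - 1 / q) * (v powr (p / q)) powr q"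
        using that s by (intro young_powr q) auto
      moreover have "(v powr (p / q)) powr (q - 1) = v powr (p - p / q)"
        using q by (simp add: powr_powr field_simps)
      moreover have "(v powr (p / q)) powr q = v powr p" using q by (simp add: powr_powr)
      moreover have "(u / s) powr q = u powr q / s powr q" using that s by (simp add: powr_divide)
      ultimately have "s * (u / s * v powr (p - p / q)) \<le> s * (u powr q / s powr q / q + (1 - 1 / q) * v powr p)"
        using s by (intro mult_left_mono) auto
      moreover have "s powr (1 - q) / q * u powr q = s * (u powr q / s powr q / q)"
        using s by (simp add: powr_diff)
      ultimately show ?thesis using s by (simp add: distrib_left)
    qed
    have "?d x \<le> (\<Sum>i\<in>S. (s powr (1 - q) / q * cmod (g (pr i x)) powr q + s * (1 - 1 / q) * h (pr i x) powr p) * wt i x)"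
      by (intro sum_mono mult_right_mono pt wt_nonneg h_nonneg) auto
    also have "\<dots> = s powr (1 - q) / q * ?G x + s * (1 - 1 / q) * (\<Sum>i\<in>S. h (pr i x) powr p * wt i x)"
      by (simp add: distrib_right sum.distrib sum_distrib_left mult.assoc)
    finally show ?thesis unfolding sum_wt_self .
  qed
  have dm: "?d \<in> borel_measurable N"
  proof -
    have [measurable]: "g \<in> borel_measurable K" "h \<in> borel_measurable K" by (rule gm h_meas)+
    have "(\<lambda>y. cmod (g y)) \<in> borel_measurable K" "(\<lambda>y. h y powr (p - p / q)) \<in> borel_measurable K" by measurable
    from this[THEN measurable_comp_pr[rotated]] show ?thesis
      by (intro borel_measurable_sum borel_measurable_times measurable_wt) auto
  qed
  have d0: "0 \<le> ?d x" for x by (intro sum_nonneg mult_nonneg_nonneg wt_nonneg) auto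
  show di: "integrable N ?d"
  proof (rule Bochner_Integration.integrable_bound[OF _ dm])
    show "integrable N (\<lambda>x. 1 powr (1 - q) / q * ?G x + 1 * (1 - 1 / q) * ?H x)"
      using iG iH by (intro Bochner_Integration.integrable_add integrable_mult_right) auto
    show "AE x in N. norm (?d x) \<le> norm (1 powr (1 - q) / q * ?G x + 1 * (1 - 1 / q) * ?H x)"
      using young[of 1] d0 by (intro AE_I2) (smt (verit) real_norm_def)
  qed
  \<comment> \<open>With s strictly above the norm, s is positive even when the norm is 0, and both
    Young terms add up to |S| * s. Finally s decreases to the norm.\<close>
  have "integral\<^sup>L N ?d \<le> card S * s" if s: "nrm q g < s" for s :: real
  proof -
    have s0: "0 < s" using s nrm_nonneg[of q g] by linarith
    have "integral\<^sup>L N ?d \<le> integral\<^sup>L N (\<lambda>x. s powr (1 - q) / q * ?G x + s * (1 - 1 / q) * ?H x)"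
      using iG iH young[OF s0] di
      by (intro integral_mono Bochner_Integration.integrable_add integrable_mult_right) auto
    also have "\<dots> = s powr (1 - q) / q * integral\<^sup>L N ?G + s * (1 - 1 / q) * card S"
      using iG iH coneD(3)[OF h_cone] by (simp add: integral_tensor_self)
    also have "\<dots> \<le> s powr (1 - q) / q * (card S * s powr q) + s * (1 - 1 / q) * card S"
    proof -
      have "gauge (\<lambda>y. cmod (g y) powr q) = nrm q g powr q"
        using q by (simp add: nrm_def powr_powr)
      also have "\<dots> \<le> s powr q" using s q by (intro powr_mono2) auto
      finally have "real (card S) * gauge (\<lambda>y. cmod (g y) powr q) \<le> card S * s powr q"
        by (intro mult_left_mono) auto
      then have "integral\<^sup>L N ?G \<le> card S * s powr q" using sum_wt(2)[OF gc] by linarith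
      then show ?thesis using q by (intro add_right_mono mult_left_mono) auto
    qed
    also have "\<dots> = card S * s"
    proof -
      have "s powr (1 - q) * s powr q = s" using s0 by (simp add: powr_add[symmetric])
      then have "s powr (1 - q) / q * (card S * s powr q) = card S * s / q" by (simp add: field_simps)
      then show ?thesis using q by (simp add: field_simps)
    qed
    finally show ?thesis .
  qed
  then have "integral\<^sup>L N ?d / card S \<le> s" if "nrm q g < s" for s
    using that card_S_pos by (simp add: divide_le_eq mult.commute)
  then have "integral\<^sup>L N ?d / card S \<le> nrm q g" by (rule dense_ge)
  then show "integral\<^sup>L N ?d \<le> card S * nrm q g"
    using card_S_pos by (simp add: divide_le_eq mult.commute)
qed

lemma lin_bound:
  assumes q: "1 \<le> q" and g: "g \<in> Lsp q" and m: "m \<in> borel_measurable K"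
    and B: "0 \<le> B" "\<And>y. cmod (m y) \<le> B * h y powr (p - p / q)"
  shows "integrable N (dens m g)" "cmod (lin m g) \<le> B * (card S * nrm q g)"
proof -
  let ?d = "\<lambda>x. \<Sum>i\<in>S. cmod (g (pr i x)) * h (pr i x) powr (p - p / q) * wt i x"
  have le: "cmod (dens m g x) \<le> B * ?d x" for x
  proof -
    have "cmod (dens m g x) \<le> (\<Sum>i\<in>S. cmod (m (pr i x) * g (pr i x) * of_real (wt i x)))"
      unfolding dens_def by (rule norm_sum)
    also have "\<dots> \<le> (\<Sum>i\<in>S. B * h (pr i x) powr (p - p / q) * cmod (g (pr i x)) * wt i x)"
      unfolding norm_mult norm_of_real using wt_nonneg
      by (intro sum_mono mult_mono B(2)) (auto intro!: mult_nonneg_nonneg B(1))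
    also have "\<dots> = B * ?d x" by (simp add: sum_distrib_left ac_simps)
    finally show ?thesis .
  qed
  note db = dual_bound[OF q g]
  have gm: "g \<in> borel_measurable K" using g by (auto simp: Lsp_iff)
  have iB: "integrable N (\<lambda>x. B * ?d x)" using db(1) by (rule integrable_mult_right)
  show i: "integrable N (dens m g)"
    by (rule Bochner_Integration.integrable_bound[OF iB measurable_dens[OF m gm]])
      (use le in \<open>auto intro!: AE_I2 order_trans[OF _ abs_ge_self]\<close>)
  have "cmod (lin m g) \<le> integral\<^sup>L N (\<lambda>x. B * ?d x)"
    unfolding lin_def
    by (rule order_trans[OF integral_norm_bound integral_mono[OF integrable_norm[OF i] iB le]])
  also have "\<dots> \<le> B * (card S * nrm q g)"
    using db(2) B(1) by (simp add: mult_left_mono)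
  finally show "cmod (lin m g) \<le> B * (card S * nrm q g)" .
qed

text \<open>Domination of m by both weights bounds the functional on each summand of a decomposition
  of g with the same constant; the infimum over decompositions gives the sum norm.\<close>

lemma lin_sum_space:
  assumes p: "1 \<le> p0" "1 \<le> p1" and g: "g \<in> sum_space (Lsp p0) (Lsp p1)" and m: "m \<in> borel_measurable K"
    and B: "0 < B" "\<And>y. cmod (m y) \<le> B * h y powr (p - p / p0)" "\<And>y. cmod (m y) \<le> B * h y powr (p - p / p1)"
  shows "integrable N (dens m g)"
    "cmod (lin m g) \<le> B * card S * sum_norm (Lsp p0) (nrm p0) (Lsp p1) (nrm p1) g"
proof -
  have *: "integrable N (dens m (\<lambda>y. f0 y + f1 y)) \<and> cmod (lin m (\<lambda>y. f0 y + f1 y)) \<le> B * card S * (nrm p0 f0 + nrm p1 f1)"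
    if "f0 \<in> Lsp p0" "f1 \<in> Lsp p1" for f0 f1
  proof -
    have eq: "dens m (\<lambda>y. f0 y + f1 y) = (\<lambda>x. dens m f0 x + dens m f1 x)"
      by (auto simp: dens_def sum.distrib[symmetric] algebra_simps)
    note b = lin_bound[OF p(1) that(1) m less_imp_le[OF B(1)] B(2)] lin_bound[OF p(2) that(2) m less_imp_le[OF B(1)] B(3)]
    have "lin m (\<lambda>y. f0 y + f1 y) = lin m f0 + lin m f1"
      unfolding lin_def eq using b(1,3) by simp
    then have "cmod (lin m (\<lambda>y. f0 y + f1 y)) \<le> cmod (lin m f0) + cmod (lin m f1)"
      by (simp add: norm_triangle_ineq)
    then show ?thesis using b unfolding eq by (auto simp: algebra_simps)
  qed
  show "integrable N (dens m g)" using * g by (auto simp: sum_space_def)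
  have pos: "0 < B * card S" using B card_S_pos by simp
  have "cmod (lin m g) / (B * card S) \<le> sum_norm (Lsp p0) (nrm p0) (Lsp p1) (nrm p1) g"
    unfolding sum_norm_def
  proof (rule cInf_greatest)
    fix v assume "v \<in> {nrm p0 f0 + nrm p1 f1 |f0 f1. f0 \<in> Lsp p0 \<and> f1 \<in> Lsp p1 \<and> g = (\<lambda>x. f0 x + f1 x)}"
    then show "cmod (lin m g) / (B * card S) \<le> v"
      using * pos by (auto simp: divide_le_eq mult.commute)
  qed (use g in \<open>auto simp: sum_space_def\<close>)
  then show "cmod (lin m g) \<le> B * card S * sum_norm (Lsp p0) (nrm p0) (Lsp p1) (nrm p1) g"
    using pos by (simp add: divide_le_eq mult.commute)
qed

lemma dens_lin_right: "dens m (\<lambda>y. a * f y + b * g y) = (\<lambda>x. a * dens m f x + b * dens m g x)"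
  by (auto simp: dens_def sum_distrib_left sum.distrib[symmetric] algebra_simps)

lemma lin_lin_right:
  "integrable N (dens m f) \<Longrightarrow> integrable N (dens m g) \<Longrightarrow> lin m (\<lambda>y. a * f y + b * g y) = a * lin m f + b * lin m g"
  unfolding lin_def dens_lin_right by simp

lemma lin_sum_left:
  assumes "\<And>c. c \<in> V \<Longrightarrow> integrable N (dens (m c) g)"
  shows "lin (\<lambda>y. \<Sum>c\<in>V. k c * m c y) g = (\<Sum>c\<in>V. k c * lin (m c) g)"
    "integrable N (dens (\<lambda>y. \<Sum>c\<in>V. k c * m c y) g)"
proof -
  have eq: "dens (\<lambda>y. \<Sum>c\<in>V. k c * m c y) g = (\<lambda>x. \<Sum>c\<in>V. k c * dens (m c) g x)"
    unfolding dens_def sum_distrib_left sum_distrib_right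
    by (subst sum.swap) (simp add: mult.assoc)
  show "lin (\<lambda>y. \<Sum>c\<in>V. k c * m c y) g = (\<Sum>c\<in>V. k c * lin (m c) g)"
    unfolding lin_def eq using assms by (simp add: Bochner_Integration.integral_sum)
  show "integrable N (dens (\<lambda>y. \<Sum>c\<in>V. k c * m c y) g)"
    unfolding eq using assms by (intro Bochner_Integration.integrable_sum integrable_mult_right) auto
qed

end

section \<open>The lower bound\<close>

context interpolation
begin

text \<open>Boundedness along the edges makes the suprema in \<open>calderon_norm\<close> genuine
  upper bounds.\<close>

lemma calderon_adm_boundary:
  assumes adm: "calderon_adm (Lsp p0) (nrm p0) (Lsp p1) (nrm p1) F"
  shows "nrm p0 (F (\<i> * of_real t)) \<le> calderon_norm (nrm p0) (nrm p1) F"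
    "nrm p1 (F (1 + \<i> * of_real t)) \<le> calderon_norm (nrm p0) (nrm p1) F"
proof -
  have b: "bdd_above (range (\<lambda>t. nrm p0 (F (\<i> * of_real t))))" "bdd_above (range (\<lambda>t. nrm p1 (F (1 + \<i> * of_real t))))"
    using adm unfolding calderon_adm_def by (auto intro!: nrm_bdd_above pp)
  show "nrm p0 (F (\<i> * of_real t)) \<le> calderon_norm (nrm p0) (nrm p1) F"
    unfolding calderon_norm_def by (rule max.coboundedI1, rule cSUP_upper[OF _ b(1)]) simp
  show "nrm p1 (F (1 + \<i> * of_real t)) \<le> calderon_norm (nrm p0) (nrm p1) F"
    unfolding calderon_norm_def by (rule max.coboundedI2, rule cSUP_upper[OF _ b(2)]) simp
qed

text \<open>The test function is h^(p - expo z) times the conjugate sign of F \<theta>. On the edges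
  its modulus is at most h^(p - p / p0) or h^(p - p / p1), the weights of the Hoelder bound, so
  pairing it with F z gives at most |S| times the Calderon norm. At \<theta> the pairing is at least
  T * |S|, and the three lines theorem compares the two.\<close>

lemma dual_lower_bound:
  assumes adm: "calderon_adm (Lsp p0) (nrm p0) (Lsp p1) (nrm p1) F"
    and th: "0 < \<theta>" "\<theta> < 1"
    and h: "h \<in> borel_measurable K" "\<And>y. 0 \<le> h y" "finite (range h)"
    and hc: "(\<lambda>y. h y powr p) \<in> cone" "gauge (\<lambda>y. h y powr p) = 1"
    and T: "0 \<le> T" "\<And>y. T * h y \<le> cmod (F (of_real \<theta>) y)"
  shows "T \<le> calderon_norm (nrm p0) (nrm p1) F"
proof -
  interpret dual_functional N K S pr p h
    by unfold_locales (use h hc in auto)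
  let ?C = "calderon_norm (nrm p0) (nrm p1) F"
  note F = adm[unfolded calderon_adm_def]
  define V where "V = range h - {0}"
  have V: "finite V" "\<And>c. c \<in> V \<Longrightarrow> 0 < c"
    using h by (auto simp: V_def less_le)
  define f where "f = F (of_real \<theta>)"
  have ths: "of_real \<theta> \<in> strip" using th by (auto simp: strip_def)
  have f: "f \<in> sum_space (Lsp p0) (Lsp p1)" using F ths by (auto simp: f_def)
  then have fm: "f \<in> borel_measurable K"
    by (auto simp: sum_space_def Lsp_iff)
  define m where "m c y = (if h y = c then cnj (sgn (f y)) else 0)" for c y
  \<comment> \<open>Grouping by the nonzero values c of h leaves z only in scalar coefficients, so
    holomorphy reduces to that of the functions z -> lin (m c) (F z).\<close>
  define mz where "mz z y = (\<Sum>c\<in>V. exp ((of_real p - expo z) * of_real (ln c)) * m c y)" for z y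
  have hm: "Measurable.pred K (\<lambda>y. h y = c)" for c
    using h(1) by measurable
  have mm: "m c \<in> borel_measurable K" for c
  proof -
    have "(\<lambda>y. cnj (sgn (f y))) \<in> borel_measurable K"
      unfolding complex_sgn_def using fm by (intro borel_measurable_continuous_on[OF _ borel_measurable_scaleR] borel_measurable_inverse) (auto intro: continuous_intros)
    then show ?thesis unfolding m_def[abs_def] using hm[of c] by measurable
  qed
  have mzm: "mz z \<in> borel_measurable K" for z
    unfolding mz_def[abs_def] by (intro borel_measurable_sum borel_measurable_times mm) auto
  have mz_eq: "mz z y = (if h y = 0 then 0 else exp ((of_real p - expo z) * of_real (ln (h y))) * cnj (sgn (f y)))" for z y
  proof -
    have "mz z y = (\<Sum>c\<in>V. if c = h y then exp ((of_real p - expo z) * of_real (ln (h y))) * cnj (sgn (f y)) else 0)"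
      unfolding mz_def m_def by (intro sum.cong) auto
    also have "\<dots> = (if h y \<in> V then exp ((of_real p - expo z) * of_real (ln (h y))) * cnj (sgn (f y)) else 0)"
      using V(1) by (simp add: sum.delta)
    finally show ?thesis by (auto simp: V_def)
  qed
  have sgn1: "cmod (sgn u) \<le> 1" for u :: complex by (simp add: norm_sgn)
  have mz_le: "cmod (mz z y) \<le> 1 * h y powr (p - Re (expo z))" for z y
  proof (cases "h y = 0")
    case False
    then have "0 < h y" using h(2)[of y] by linarith
    then show ?thesis using sgn1[of "f y"] False
      by (auto simp: mz_eq norm_mult powr_def mult_left_le)
  qed (auto simp: mz_eq)
  \<comment> \<open>On the level set h = c the quotient of h powr s by c powr s is 1, so
    \<open>B c\<close> dominates \<open>m c\<close> by both weights simultaneously.\<close>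
  define B where "B c = max (c powr - (p - p / p0)) (c powr - (p - p / p1))" for c
  have B: "0 < B c" if "c \<in> V" for c using V(2)[OF that] by (auto simp: B_def less_max_iff_disj)
  have m_le: "cmod (m c y) \<le> B c * h y powr (p - p / p0)" "cmod (m c y) \<le> B c * h y powr (p - p / p1)" if "c \<in> V" for c y
  proof -
    have "cmod (m c y) \<le> c powr - s * h y powr s" for s
      using V(2)[OF that] sgn1[of "f y"] by (auto simp: m_def powr_add[symmetric])
    moreover have "c powr - s * h y powr s \<le> B c * h y powr s" if "s \<in> {p - p / p0, p - p / p1}" for s
      using that by (intro mult_right_mono) (auto simp: B_def)
    ultimately show "cmod (m c y) \<le> B c * h y powr (p - p / p0)" "cmod (m c y) \<le> B c * h y powr (p - p / p1)"
      by (meson insertI1 insertI2 order_trans singletonI)+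
  qed
  note lin_s = lin_sum_space[OF p0 p1 _ mm B m_le]
  define \<phi> where "\<phi> z = (\<Sum>c\<in>V. exp ((of_real p - expo z) * of_real (ln c)) * lin (m c) (F z))" for z
  have \<phi>_eq: "\<phi> z = lin (mz z) (F z)" "integrable N (dens (mz z) (F z))" if "z \<in> strip" for z
  proof -
    have "F z \<in> sum_space (Lsp p0) (Lsp p1)" using F that by blast
    then have i: "\<And>c. c \<in> V \<Longrightarrow> integrable N (dens (m c) (F z))" by (intro lin_s)
    show "\<phi> z = lin (mz z) (F z)" "integrable N (dens (mz z) (F z))"
      unfolding \<phi>_def mz_def[abs_def] using lin_sum_left[of V m "F z"] i by simp_all
  qed
  have diff: "lin (m c) (\<lambda>x. F w x - F z x) = lin (m c) (F w) - lin (m c) (F z)"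
    "(\<lambda>x. F w x - F z x) \<in> sum_space (Lsp p0) (Lsp p1)"
    if "c \<in> V" "z \<in> strip" "w \<in> strip" for c z w
  proof -
    have s: "F z \<in> sum_space (Lsp p0) (Lsp p1)" "F w \<in> sum_space (Lsp p0) (Lsp p1)" using F that by blast+
    show "lin (m c) (\<lambda>x. F w x - F z x) = lin (m c) (F w) - lin (m c) (F z)"
      using lin_lin_right[OF lin_s(1)[OF s(2) that(1,1,1)] lin_s(1)[OF s(1) that(1,1,1)], of 1 "-1"] by simp
    show "(\<lambda>x. F w x - F z x) \<in> sum_space (Lsp p0) (Lsp p1)"
      using sum_space_lin[OF pp s(2) s(1), of 1 "-1"] by simp
  qed
  have cont_c: "continuous_on strip (\<lambda>z. lin (m c) (F z))" if c: "c \<in> V" for c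
    unfolding continuous_on_def
  proof
    fix z assume z: "z \<in> strip"
    have "((\<lambda>w. lin (m c) (F w) - lin (m c) (F z)) \<longlongrightarrow> 0) (at z within strip)"
    proof (rule Lim_null_comparison)
      have "\<forall>\<^sub>F w in at z within strip. w \<in> strip" by (auto simp: eventually_at_filter)
      then show "\<forall>\<^sub>F w in at z within strip. cmod (lin (m c) (F w) - lin (m c) (F z))
          \<le> B c * card S * snorm (\<lambda>x. F w x - F z x)"
      proof eventually_elim
        case (elim w)
        show ?case using lin_s(2)[OF diff(2)[OF c z elim] c c c] diff(1)[OF c z elim] by simp
      qed
      show "((\<lambda>w. B c * card S * snorm (\<lambda>x. F w x - F z x)) \<longlongrightarrow> 0) (at z within strip)"
        using F z by (intro tendsto_mult_right_zero) blast
    qed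
    then show "((\<lambda>w. lin (m c) (F w)) \<longlongrightarrow> lin (m c) (F z)) (at z within strip)"
      by (simp add: LIM_zero_iff)
  qed
  have hol_c: "(\<lambda>z. lin (m c) (F z)) holomorphic_on {z. 0 < Re z \<and> Re z < 1}" if c: "c \<in> V" for c
  proof (rule holomorphic_onI)
    fix z assume "z \<in> {z. 0 < Re z \<and> Re z < 1}"
    then have z: "0 < Re z" "Re z < 1" and zs: "z \<in> strip" by (auto simp: strip_def)
    obtain D where D: "D \<in> sum_space (Lsp p0) (Lsp p1)"
      "((\<lambda>w. snorm (\<lambda>x. (F w x - F z x) / (w - z) - D x)) \<longlongrightarrow> 0) (at z)"
      using F z by blast
    have "((\<lambda>w. (lin (m c) (F w) - lin (m c) (F z)) / (w - z) - lin (m c) D) \<longlongrightarrow> 0) (at z)"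
    proof (rule Lim_null_comparison)
      have "open {z. 0 < Re z \<and> Re z < 1}"
        by (intro open_Collect_conj open_halfspace_Re_gt open_halfspace_Re_lt)
      then have "\<forall>\<^sub>F w in at z. w \<in> {z. 0 < Re z \<and> Re z < 1}"
        using z by (intro eventually_at_in_open') auto
      then show "\<forall>\<^sub>F w in at z. cmod ((lin (m c) (F w) - lin (m c) (F z)) / (w - z) - lin (m c) D)
          \<le> B c * card S * snorm (\<lambda>x. (F w x - F z x) / (w - z) - D x)"
      proof eventually_elim
        case (elim w)
        then have w: "w \<in> strip" by (auto simp: strip_def)
        note d = diff[OF c zs w]
        have eq: "(\<lambda>x. (F w x - F z x) / (w - z) - D x) = (\<lambda>x. inverse (w - z) * (F w x - F z x) + (-1) * D x)"
          by (auto simp: field_simps)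
        have L: "lin (m c) (\<lambda>x. (F w x - F z x) / (w - z) - D x) = (lin (m c) (F w) - lin (m c) (F z)) / (w - z) - lin (m c) D"
          unfolding eq using lin_lin_right[OF lin_s(1)[OF d(2) c c c] lin_s(1)[OF D(1) c c c], of "inverse (w - z)" "-1"] d(1)
          by (simp add: divide_inverse mult.commute)
        have "(\<lambda>x. (F w x - F z x) / (w - z) - D x) \<in> sum_space (Lsp p0) (Lsp p1)"
          unfolding eq by (rule sum_space_lin[OF pp d(2) D(1)])
        from lin_s(2)[OF this c c c] show ?case unfolding L .
      qed
      show "((\<lambda>w. B c * card S * snorm (\<lambda>x. (F w x - F z x) / (w - z) - D x)) \<longlongrightarrow> 0) (at z)"
        using D(2) by (intro tendsto_mult_right_zero)
    qed
    then have "((\<lambda>z. lin (m c) (F z)) has_field_derivative lin (m c) D) (at z)"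
      unfolding has_field_derivative_iff by (rule LIM_zero_cancel)
    then show "(\<lambda>z. lin (m c) (F z)) field_differentiable at z within {z. 0 < Re z \<and> Re z < 1}"
      unfolding field_differentiable_def
      by (intro exI[of _ "lin (m c) D"]) (rule has_field_derivative_at_within)
  qed
  have "\<exists>Bc. \<forall>z\<in>strip. snorm (F z) \<le> Bc" using F by blast
  then obtain Bc where Bc: "\<And>z. z \<in> strip \<Longrightarrow> snorm (F z) \<le> Bc" by blast
  have expo_strip: "cmod (exp ((of_real p - expo z) * of_real (ln c))) \<le> exp ((p + a0 + a1) * \<bar>ln c\<bar>)" if "z \<in> strip" for z c
  proof -
    have "Re ((of_real p - expo z) * of_real (ln c)) \<le> \<bar>p - Re (expo z)\<bar> * \<bar>ln c\<bar>"
      by (simp add: abs_mult[symmetric])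
    also have "\<dots> \<le> (p + a0 + a1) * \<bar>ln c\<bar>"
      using Re_expo_bounds[OF that] p_pos by (intro mult_right_mono) auto
    finally show ?thesis by simp
  qed
  have bdd: "cmod (\<phi> z) \<le> (\<Sum>c\<in>V. exp ((p + a0 + a1) * \<bar>ln c\<bar>) * (B c * card S * Bc))" if z: "z \<in> strip" for z
    unfolding \<phi>_def
  proof (rule order_trans[OF norm_sum], rule sum_mono)
    fix c assume c: "c \<in> V"
    have "F z \<in> sum_space (Lsp p0) (Lsp p1)" using F z by blast
    then have "cmod (lin (m c) (F z)) \<le> B c * card S * snorm (F z)"
      using c by (intro lin_s(2))
    also have "\<dots> \<le> B c * card S * Bc"
      using B[OF c] by (intro mult_left_mono Bc z) auto
    finally show "cmod (exp ((of_real p - expo z) * of_real (ln c)) * lin (m c) (F z))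
        \<le> exp ((p + a0 + a1) * \<bar>ln c\<bar>) * (B c * card S * Bc)"
      unfolding norm_mult using expo_strip[OF z] by (intro mult_mono) auto
  qed
  have bl: "cmod (\<phi> (\<i> * of_real t)) \<le> card S * ?C" for t
  proof -
    have zs: "\<i> * of_real t \<in> strip" by (auto simp: strip_def)
    have "Re (expo (\<i> * of_real t)) = p / p0" by (simp add: Re_expo a0_def)
    then have le: "\<And>y. cmod (mz (\<i> * of_real t) y) \<le> 1 * h y powr (p - p / p0)" using mz_le by metis
    have X: "F (\<i> * of_real t) \<in> Lsp p0" using F by blast
    have "cmod (\<phi> (\<i> * of_real t)) \<le> 1 * (card S * nrm p0 (F (\<i> * of_real t)))"
      unfolding \<phi>_eq(1)[OF zs] by (rule lin_bound(2)[OF p0 X mzm _ le]) simp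
    also have "\<dots> \<le> card S * ?C"
      using calderon_adm_boundary(1)[OF adm, of t] by (simp add: mult_left_mono)
    finally show ?thesis .
  qed
  have br: "cmod (\<phi> (1 + \<i> * of_real t)) \<le> card S * ?C" for t
  proof -
    have zs: "1 + \<i> * of_real t \<in> strip" by (auto simp: strip_def)
    have "Re (expo (1 + \<i> * of_real t)) = p / p1" by (simp add: Re_expo a1_def)
    then have le: "\<And>y. cmod (mz (1 + \<i> * of_real t) y) \<le> 1 * h y powr (p - p / p1)" using mz_le by metis
    have X: "F (1 + \<i> * of_real t) \<in> Lsp p1" using F by blast
    have "cmod (\<phi> (1 + \<i> * of_real t)) \<le> 1 * (card S * nrm p1 (F (1 + \<i> * of_real t)))"
      unfolding \<phi>_eq(1)[OF zs] by (rule lin_bound(2)[OF p1 X mzm _ le]) simp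
    also have "\<dots> \<le> card S * ?C"
      using calderon_adm_boundary(2)[OF adm, of t] by (simp add: mult_left_mono)
    finally show ?thesis .
  qed
  have upper: "cmod (\<phi> (of_real \<theta>)) \<le> card S * ?C"
  proof (rule three_lines[OF _ _ bdd bl br ths])
    show "\<phi> holomorphic_on {z. 0 < Re z \<and> Re z < 1}"
      unfolding \<phi>_def[abs_def] expo_def by (intro holomorphic_intros hol_c)
    show "continuous_on strip \<phi>"
      unfolding \<phi>_def[abs_def] expo_def by (intro continuous_intros cont_c)
  qed
  have "T * card S \<le> Re (\<phi> (of_real \<theta>))"
  proof -
    let ?t = "of_real \<theta> :: complex"
    \<comment> \<open>Since expo is 1 at \<theta>, the integrand is h^(p - 1) * |f|, at least T *
      h^p. Summed with the weights and integrated, this produces T * |S|.\<close>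
    have pt: "T * h y powr p * w \<le> Re (mz ?t y * f y * of_real w)" if w: "0 \<le> w" for y w
    proof (cases "h y = 0")
      case False
      then have hy: "0 < h y" using h(2)[of y] by linarith
      have "cnj (f y) * f y = of_real (cmod (f y)) * of_real (cmod (f y))"
        using complex_norm_square[of "f y"] by (simp add: power2_eq_square mult.commute)
      then have "cnj (sgn (f y)) * f y = of_real (cmod (f y))"
        by (cases "f y = 0") (simp_all add: sgn_eq)
      then have "mz ?t y * f y = of_real (h y powr (p - 1)) * of_real (cmod (f y))"
        using False hy by (simp add: mz_eq expo_theta powr_def mult.assoc exp_of_real[symmetric])
      then have "mz ?t y * f y * of_real w = of_real (h y powr (p - 1) * cmod (f y) * w)"
        by simp
      then have E: "Re (mz ?t y * f y * of_real w) = h y powr (p - 1) * cmod (f y) * w"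
        by (simp only: Re_complex_of_real)
      have "T * h y powr p * w = h y powr (p - 1) * (T * h y) * w"
        using hy by (simp add: powr_diff)
      also have "h y powr (p - 1) * (T * h y) * w \<le> h y powr (p - 1) * cmod (f y) * w"
        using T(2)[of y] w by (intro mult_right_mono mult_left_mono) (auto simp: f_def)
      finally show ?thesis unfolding E .
    qed (simp add: mz_eq)
    have "T * card S = integral\<^sup>L N (\<lambda>x. T * (card S * tensor (\<lambda>y. h y powr p) x))"
      using coneD(3)[OF hc(1)] by (simp add: integral_tensor_self)
    also have "\<dots> \<le> integral\<^sup>L N (\<lambda>x. Re (dens (mz ?t) f x))"
    proof (rule integral_mono)
      show "integrable N (\<lambda>x. Re (dens (mz ?t) f x))"
        using \<phi>_eq(2)[OF ths] by (intro integrable_Re) (simp add: f_def)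
      show "T * (card S * tensor (\<lambda>y. h y powr p) x) \<le> Re (dens (mz ?t) f x)" for x
        unfolding sum_wt_self[symmetric] dens_def sum_distrib_left Re_sum mult.assoc[symmetric, of T]
        by (intro sum_mono pt wt_nonneg)
    qed (use coneD(3)[OF hc(1)] in auto)
    also have "\<dots> = Re (\<phi> ?t)"
      unfolding \<phi>_eq(1)[OF ths] lin_def using \<phi>_eq(2)[OF ths] by (simp add: f_def)
    finally show ?thesis .
  qed
  also have "\<dots> \<le> card S * ?C" using upper complex_Re_le_cmod order_trans by blast
  finally show "T \<le> ?C" using card_S_pos by (simp add: mult.commute)
qed

end

section \<open>From simple minorants to the interpolated value, and the two equalities\<close>

context interpolation
begin

text \<open>A Chebyshev argument: where g is nonzero it is at least c, so one of |f0|, |f1| is at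
  least c / 2 and the corresponding power of (2 / c) * |f_j| is at least 1. Multiplying by d powr p
  gives a majorant in \<open>cone\<close>.\<close>

lemma simple_minorant_cone:
  assumes f: "f \<in> sum_space (Lsp p0) (Lsp p1)"
    and g: "g \<in> borel_measurable K" "\<And>y. 0 \<le> g y" "finite (range g)" "\<And>y. g y \<le> cmod (f y)"
  shows "(\<lambda>y. g y powr p) \<in> cone"
proof -
  obtain f0 f1 where f01: "f0 \<in> Lsp p0" "f1 \<in> Lsp p1" and f_eq: "f = (\<lambda>y. f0 y + f1 y)"
    using f by (auto simp: sum_space_def)
  \<comment> \<open>The inserted 1 keeps the finite set nonempty, so Min and Max are meaningful also
    when g vanishes identically.\<close>
  define c d where "c = Min (insert 1 (range g - {0}))" and "d = Max (insert 1 (range g - {0}))"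
  have fin: "finite (insert 1 (range g - {0}))" using g(3) by auto
  have cd: "0 < c" "c \<le> g y" "g y \<le> d" if "g y \<noteq> 0" for y
  proof -
    have "\<forall>v \<in> insert 1 (range g - {0}). 0 < v" using g(2) by (auto simp: less_le)
    then show "0 < c" using fin Min_in[OF fin] by (auto simp: c_def)
    show "c \<le> g y" "g y \<le> d" unfolding c_def d_def using fin that by (auto intro!: Min_le Max_ge)
  qed
  have pw: "1 \<le> (u * (2 / c)) powr q" if "0 < q" "c / 2 \<le> u" "0 < c" for u q :: real
  proof -
    have "1 \<le> u * (2 / c)" using that by (simp add: field_simps)
    then show ?thesis using that by (intro ge_one_powr_ge_zero) auto
  qed
  have bound: "g y powr p \<le> d powr p * ((2 / c) powr p0 * cmod (f0 y) powr p0 + (2 / c) powr p1 * cmod (f1 y) powr p1)" for y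
  proof (cases "g y = 0")
    case True
    then show ?thesis by simp
  next
    case False
    note cd = cd[OF False]
    have "c \<le> cmod (f0 y) + cmod (f1 y)"
      using cd g(4)[of y] norm_triangle_ineq[of "f0 y" "f1 y"] by (simp add: f_eq)
    then consider "c / 2 \<le> cmod (f0 y)" | "c / 2 \<le> cmod (f1 y)" by linarith
    then have "1 \<le> (cmod (f0 y) * (2 / c)) powr p0 + (cmod (f1 y) * (2 / c)) powr p1"
    proof cases
      case 1
      show ?thesis using pw[OF pp(1) 1 cd(1)] by (simp add: add_increasing2)
    next
      case 2
      show ?thesis using pw[OF pp(2) 2 cd(1)] by (simp add: add_increasing)
    qed
    also have "\<dots> = (2 / c) powr p0 * cmod (f0 y) powr p0 + (2 / c) powr p1 * cmod (f1 y) powr p1"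
      using cd by (simp only: powr_mult mult.commute)
    finally have one: "1 \<le> (2 / c) powr p0 * cmod (f0 y) powr p0 + (2 / c) powr p1 * cmod (f1 y) powr p1" .
    have "g y powr p \<le> d powr p" using cd p_pos g(2) by (intro powr_mono2) auto
    also have "\<dots> \<le> d powr p * ((2 / c) powr p0 * cmod (f0 y) powr p0 + (2 / c) powr p1 * cmod (f1 y) powr p1)"
      using mult_left_mono[OF one, of "d powr p"] by simp
    finally show ?thesis .
  qed
  have "(\<lambda>y. (2 / c) powr p0 * cmod (f0 y) powr p0) \<in> cone" "(\<lambda>y. (2 / c) powr p1 * cmod (f1 y) powr p1) \<in> cone"
    using f01 by (auto simp: Lsp_iff intro!: cone_scale)
  from cone_scale(1)[OF cone_add[OF this], of "d powr p"]
  have "(\<lambda>y. d powr p * ((2 / c) powr p0 * cmod (f0 y) powr p0 + (2 / c) powr p1 * cmod (f1 y) powr p1)) \<in> cone"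
    by simp
  moreover have "(\<lambda>y. g y powr p) \<in> borel_measurable K" using g(1) by measurable
  ultimately show ?thesis by (rule cone_mono(1)) (auto intro: bound)
qed

text \<open>Simple minorants of |F \<theta>| have p-norm at most the Calderon norm by duality.
  Passing to the limit in the product forms yields integrability and the norm bound
  together.\<close>

lemma calderon_adm_lower_interior:
  assumes adm: "calderon_adm (Lsp p0) (nrm p0) (Lsp p1) (nrm p1) F"
    and th: "0 < \<theta>" "\<theta> < 1"
  shows "F (of_real \<theta>) \<in> Lsp p" "nrm p (F (of_real \<theta>)) \<le> calderon_norm (nrm p0) (nrm p1) F"
proof -
  let ?C = "calderon_norm (nrm p0) (nrm p1) F"
  define f where "f = F (of_real \<theta>)"
  have C0: "0 \<le> ?C" using calderon_adm_boundary(1)[OF adm, of 0] nrm_nonneg order_trans by blast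
  have "of_real \<theta> \<in> strip" using th by (auto simp: strip_def)
  then have f: "f \<in> sum_space (Lsp p0) (Lsp p1)" using adm by (auto simp: calderon_adm_def f_def)
  then have fm: "f \<in> borel_measurable K" by (auto simp: sum_space_def Lsp_iff)
  have simple: "gauge (\<lambda>y. g y powr p) \<le> ?C powr p"
    if g: "g \<in> borel_measurable K" "\<And>y. 0 \<le> g y" "finite (range g)" "\<And>y. g y \<le> cmod (f y)" for g
  proof -
    have gc: "(\<lambda>y. g y powr p) \<in> cone" by (rule simple_minorant_cone[OF f g])
    let ?G = "gauge (\<lambda>y. g y powr p)"
    show ?thesis
    proof (cases "?G = 0")
      case False
      then have G: "0 < ?G" using gauge_nonneg[of "\<lambda>y. g y powr p"] by linarith
      \<comment> \<open>T is the p-norm of g; dividing g by it normalises the gauge of the p-th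
        power to 1, as the functional requires.\<close>
      define T where "T = ?G powr (1 / p)"
      have T: "0 < T" "T powr p = ?G" using G p_pos by (auto simp: T_def powr_powr)
      have eq: "(\<lambda>y. (g y / T) powr p) = (\<lambda>y. (1 / ?G) * g y powr p)"
        using T g(2) by (simp add: powr_divide)
      note sc = cone_scale[OF gc, of "1 / ?G"]
      have "T \<le> ?C"
      proof (rule dual_lower_bound[OF adm th, where h = "\<lambda>y. g y / T"])
        have "range (\<lambda>y. g y / T) = (\<lambda>v. v / T) ` range g" by auto
        then show "finite (range (\<lambda>y. g y / T))" using g(3) by simp
      qed (use g T G sc in \<open>auto simp: eq f_def[symmetric]\<close>)
      then show ?thesis using T p_pos powr_mono2[of p T ?C] by simp
    qed simp
  qed
  have "(\<lambda>y. cmod (f y)) \<in> borel_measurable K" using fm by measurable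
  from borel_measurable_implies_simple_function_sequence_real[OF this]
  obtain s where s: "incseq s" "\<And>i. simple_function K (s i)" "\<And>x. bdd_above (range (\<lambda>i. s i x))"
    "\<And>i x. 0 \<le> s i x" "(\<lambda>y. cmod (f y)) = (SUP i. s i)"
    by auto
  have lim: "(\<lambda>i. s i y) \<longlonglongrightarrow> cmod (f y)" for y
  proof -
    have "cmod (f y) = (SUP i. s i y)" using s(5) by (metis SUP_apply)
    moreover have "(\<lambda>i. s i y) \<longlonglongrightarrow> (SUP i. s i y)"
      using s(1,3) by (intro LIMSEQ_incseq_SUP) (auto simp: incseq_def le_fun_def)
    ultimately show ?thesis by simp
  qed
  have sle: "s i y \<le> cmod (f y)" for i y
    using incseq_le[OF _ lim, of y i] s(1) by (auto simp: incseq_def le_fun_def)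
  \<comment> \<open>Simple functions have finitely many values on \<open>space K\<close> only; the
    cutoff makes the range finite on the whole type. It is invisible to the forms, since
    \<open>pr j\<close> maps \<open>space N\<close> into \<open>space K\<close>.\<close>
  define g where "g i y = indicator (space K) y * s i y" for i y
  have sm: "s i \<in> borel_measurable K" for i using s(2) by (rule borel_measurable_simple_function)
  have g: "g i \<in> borel_measurable K" "0 \<le> g i y" "finite (range (g i))" "g i y \<le> cmod (f y)" for i y
  proof -
    show "g i \<in> borel_measurable K" unfolding g_def[abs_def] using sm[of i] by measurable
    have "range (g i) \<subseteq> insert 0 (s i ` space K)" by (auto simp: g_def indicator_def)
    then show "finite (range (g i))"
      by (rule finite_subset) (use s(2)[of i] in \<open>simp add: simple_function_def\<close>)
    show "0 \<le> g i y" "g i y \<le> cmod (f y)" using s(4) sle by (auto simp: g_def indicator_def)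
  qed
  have gc: "(\<lambda>y. g i y powr p) \<in> cone" for i by (rule simple_minorant_cone[OF f g])
  define h where "h y = cmod (f y) powr p" for y
  have hm: "h \<in> borel_measurable K" unfolding h_def[abs_def] using fm by measurable
  have tlim: "(\<lambda>i. tensor (\<lambda>y. g i y powr p) x) \<longlonglongrightarrow> tensor h x" if x: "x \<in> space N" for x
    unfolding tensor_def h_def
  proof (intro tendsto_prod tendsto_powr2 tendsto_const always_eventually allI)
    fix j assume "j \<in> S"
    then have "pr j x \<in> space K" using measurable_space[OF pr_measurable x] by blast
    then show "(\<lambda>i. g i (pr j x)) \<longlonglongrightarrow> cmod (f (pr j x))" using lim by (simp add: g_def)
  qed (use g p_pos in auto)
  \<comment> \<open>Fatou's lemma turns the uniform bound on the minorants into finiteness for |F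
    \<theta>|, before integrability is known.\<close>
  have fatou: "(\<integral>\<^sup>+x. ennreal (tensor h x) \<partial>N) \<le> ennreal ((?C powr p) ^ card S)"
  proof -
    have "(\<integral>\<^sup>+x. ennreal (tensor h x) \<partial>N) = (\<integral>\<^sup>+x. liminf (\<lambda>i. ennreal (tensor (\<lambda>y. g i y powr p) x)) \<partial>N)"
      by (intro nn_integral_cong lim_imp_Liminf[symmetric] tendsto_ennrealI tlim) auto
    also have "\<dots> \<le> liminf (\<lambda>i. \<integral>\<^sup>+x. ennreal (tensor (\<lambda>y. g i y powr p) x) \<partial>N)"
      using measurable_tensor[OF coneD(1)[OF gc]] by (intro nn_integral_liminf) auto
    also have "\<dots> \<le> ennreal ((?C powr p) ^ card S)"
    proof (rule Liminf_le)
      show "\<forall>\<^sub>F i in sequentially. (\<integral>\<^sup>+x. ennreal (tensor (\<lambda>y. g i y powr p) x) \<partial>N) \<le> ennreal ((?C powr p) ^ card S)"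
      proof (intro always_eventually allI)
        fix i
        have "(\<integral>\<^sup>+x. ennreal (tensor (\<lambda>y. g i y powr p) x) \<partial>N) = ennreal (gauge (\<lambda>y. g i y powr p) ^ card S)"
          unfolding gauge_power[OF gc]
          by (intro nn_integral_eq_integral coneD(3)[OF gc] AE_I2 tensor_nonneg) simp
        also have "\<dots> \<le> ennreal ((?C powr p) ^ card S)"
          by (intro ennreal_leI power_mono simple g) auto
        finally show "(\<integral>\<^sup>+x. ennreal (tensor (\<lambda>y. g i y powr p) x) \<partial>N) \<le> ennreal ((?C powr p) ^ card S)" .
      qed
    qed simp
    finally show ?thesis .
  qed
  have t0: "0 \<le> tensor h x" for x by (rule tensor_nonneg) (simp add: h_def)
  have int: "integrable N (tensor h)"
    using fatou t0 by (intro integrableI_bounded measurable_tensor hm) (auto simp: le_less_trans)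
  then have hc: "h \<in> cone" using hm by (auto simp: cone_def h_def)
  then show fL: "F (of_real \<theta>) \<in> Lsp p" using fm by (auto simp: Lsp_iff h_def[abs_def] f_def)
  have "ennreal (gauge h ^ card S) \<le> ennreal ((?C powr p) ^ card S)"
    unfolding gauge_power[OF hc] using fatou nn_integral_eq_integral[OF int] t0 by simp
  then have "gauge h ^ card S \<le> (?C powr p) ^ card S" by simp
  then have "gauge h \<le> ?C powr p" using card_S_pos by (metis gauge_nonneg power_mono_iff powr_ge_zero)
  then have "gauge h powr (1 / p) \<le> (?C powr p) powr (1 / p)" using p_pos by (intro powr_mono2) auto
  then show "nrm p (F (of_real \<theta>)) \<le> ?C"
    using C0 p_pos by (simp add: nrm_def h_def[abs_def] f_def powr_powr)
qed

text \<open>At the endpoints p equals p0 or p1 and F \<theta> is a boundary value, already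
  controlled by the supremum over that edge.\<close>

lemma calderon_adm_lower:
  assumes adm: "calderon_adm (Lsp p0) (nrm p0) (Lsp p1) (nrm p1) F"
  shows "F (of_real \<theta>) \<in> Lsp p \<and> nrm p (F (of_real \<theta>)) \<le> calderon_norm (nrm p0) (nrm p1) F"
proof -
  consider "\<theta> = 0" | "\<theta> = 1" | "0 < \<theta>" "\<theta> < 1" using \<theta> by linarith
  then show ?thesis
  proof cases
    case 1
    then have "p = p0" using p_eq by simp
    moreover have "F (\<i> * of_real 0) \<in> Lsp p0" using adm unfolding calderon_adm_def by blast
    ultimately show ?thesis using 1 calderon_adm_boundary(1)[OF adm, of 0] by simp
  next
    case 2
    then have "p = p1" using p_eq by simp
    moreover have "F (1 + \<i> * of_real 0) \<in> Lsp p1" using adm unfolding calderon_adm_def by blast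
    ultimately show ?thesis using 2 calderon_adm_boundary(2)[OF adm, of 0] by simp
  next
    case 3
    then show ?thesis using calderon_adm_lower_interior[OF adm] by blast
  qed
qed

lemma interp_space_eq: "interp_space (Lsp p0) (nrm p0) (Lsp p1) (nrm p1) \<theta> = Lsp p"
proof
  show "interp_space (Lsp p0) (nrm p0) (Lsp p1) (nrm p1) \<theta> \<subseteq> Lsp p"
    using calderon_adm_lower by (auto simp: interp_space_def)
  show "Lsp p \<subseteq> interp_space (Lsp p0) (nrm p0) (Lsp p1) (nrm p1) \<theta>"
  proof
    fix f assume "f \<in> Lsp p"
    \<comment> \<open>Membership asks for no norm estimate, so the parameters e = 1 and l = 0
      suffice.\<close>
    then have "calderon_adm (Lsp p0) (nrm p0) (Lsp p1) (nrm p1) (fam 1 0 f)"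
      by (rule calderon_adm_fam) simp
    then show "f \<in> interp_space (Lsp p0) (nrm p0) (Lsp p1) (nrm p1) \<theta>"
      unfolding interp_space_def
      by (intro CollectI exI[of _ "fam 1 0 f"] conjI) (simp_all add: fam_theta)
  qed
qed

text \<open>The family overshoots by the damping factor exp e, so the upper bound for the infimum is
  obtained as e decreases to 0.\<close>

lemma interp_norm_eq:
  assumes f: "f \<in> Lsp p"
  shows "interp_norm (Lsp p0) (nrm p0) (Lsp p1) (nrm p1) \<theta> f = nrm p f"
proof -
  let ?A = "{calderon_norm (nrm p0) (nrm p1) F | F.
    calderon_adm (Lsp p0) (nrm p0) (Lsp p1) (nrm p1) F \<and> F (complex_of_real \<theta>) = f}"
  have mem: "calderon_norm (nrm p0) (nrm p1) (fam e (ln (nrm p f)) f) \<in> ?A" if "0 < e" for e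
    using calderon_adm_fam[OF f that] fam_theta by blast
  have low: "nrm p f \<le> v" if "v \<in> ?A" for v
    using that calderon_adm_lower by blast
  have "Inf ?A \<le> exp e * nrm p f" if "0 < e" for e
    using cInf_lower[OF mem[OF that]] calderon_norm_fam[OF f that] low
    by (meson bdd_belowI order_trans)
  then have "\<forall>\<^sub>F e in at_right 0. Inf ?A \<le> exp e * nrm p f"
    using eventually_at_right_less[of "0::real"] by (auto elim: eventually_mono)
  moreover have "((\<lambda>e. exp e * nrm p f) \<longlongrightarrow> exp 0 * nrm p f) (at_right 0)"
    by (intro tendsto_intros)
  ultimately have "Inf ?A \<le> exp 0 * nrm p f"
    by (intro tendsto_lowerbound) auto
  moreover have "nrm p f \<le> Inf ?A"
    using mem[of 1] low by (intro cInf_greatest) auto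
  ultimately show ?thesis by (simp add: interp_norm_def)
qed

end

section \<open>Hypergraph pairs of Type I\<close>

definition hsupp :: "'v hgpair \<Rightarrow> (nat \<Rightarrow> 'v) set" where
  "hsupp H = {\<omega> \<in> hverts H. halpha H \<omega> \<noteq> 0 \<or> hbeta H \<omega> \<noteq> 0}"

lemma hsupp_cases:
  assumes "typeI H 1"
  shows "\<omega> \<in> hsupp H \<Longrightarrow> halpha H \<omega> = 1 / 2 \<and> hbeta H \<omega> = 1 / 2"
    "\<omega> \<in> hverts H - hsupp H \<Longrightarrow> halpha H \<omega> = 0 \<and> hbeta H \<omega> = 0"
  using assms by (auto simp: hsupp_def typeI_def)

lemma hscale_simps [simp]:
  "hk (hscale r H) = hk H" "hV (hscale r H) = hV H" "hverts (hscale r H) = hverts H"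
  "halpha (hscale r H) \<omega> = r * halpha H \<omega>" "hbeta (hscale r H) \<omega> = r * hbeta H \<omega>"
  "hspace (hscale r H) M = hspace H M" "kspace (hscale r H) M = kspace H M"
  "hproj (hscale r H) = hproj H" "hscale 1 H = H"
  by (simp_all add: hscale_def hverts_def hspace_def kspace_def hproj_def fun_eq_iff)

lemma finite_hverts: "hgpair_wf H \<Longrightarrow> finite (hverts H)"
  unfolding hverts_def hgpair_wf_def by (intro finite_PiE) auto

text \<open>For r = 0 the identity fails at z = 0: \<open>cpow\<close> gives 1 there, whereas
  \<open>0 powr 0\<close> is 0.\<close>

lemma cpow_mult_cnj: "r \<noteq> 0 \<Longrightarrow> cpow z r * cnj (cpow z r) = of_real (cmod z powr (2 * r))"
proof -
  assume "r \<noteq> 0"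
  then have "cpow z r * cnj (cpow z r) = of_real ((cmod z powr r)^2)"
    by (simp add: cpow_def complex_norm_square[symmetric] norm_powr_real_powr')
  also have "(cmod z powr r)^2 = cmod z powr (2 * r)"
    by (simp add: power2_eq_square powr_add[symmetric])
  finally show ?thesis .
qed

text \<open>With both weights equal to 1 / 2, a power of exponent r / 2 meets its conjugate and the
  phase cancels, so f^(rH) sees only |f|. Off the support the convention 0^0 = 1 turns the factors
  into 1.\<close>

lemma hpow_hscale:
  assumes "hgpair_wf H" "typeI H 1" "r \<noteq> 0"
  shows "hpow (hscale r H) f x = of_real (\<Prod>\<omega>\<in>hsupp H. cmod (f (hproj H \<omega> x)) powr r)"
proof -
  have "hpow (hscale r H) f x = (\<Prod>\<omega>\<in>hsupp H.
      cpow (f (hproj H \<omega> x)) (r * halpha H \<omega>) * cnj (cpow (f (hproj H \<omega> x)) (r * hbeta H \<omega>)))"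
    unfolding hpow_def hscale_simps
    by (rule prod.mono_neutral_right[OF finite_hverts[OF assms(1)]])
      (use hsupp_cases(2)[OF assms(2)] in \<open>auto simp: hsupp_def cpow_def\<close>)
  also have "\<dots> = (\<Prod>\<omega>\<in>hsupp H. of_real (cmod (f (hproj H \<omega> x)) powr r))"
  proof (intro prod.cong refl)
    fix \<omega> assume "\<omega> \<in> hsupp H"
    then have half: "halpha H \<omega> = 1 / 2" "hbeta H \<omega> = 1 / 2" using hsupp_cases(1)[OF assms(2)] by blast+
    show "cpow (f (hproj H \<omega> x)) (r * halpha H \<omega>) * cnj (cpow (f (hproj H \<omega> x)) (r * hbeta H \<omega>))
      = of_real (cmod (f (hproj H \<omega> x)) powr r)"
      unfolding half using cpow_mult_cnj[of "r * (1 / 2)"] assms(3) by simp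
  qed
  finally show ?thesis by simp
qed

lemma hsize_hscale:
  assumes "hgpair_wf H" "typeI H 1" "0 \<le> r"
  shows "hsize (hscale r H) = r * card (hsupp H)"
proof -
  have "hsize (hscale r H) = (\<Sum>\<omega>\<in>hsupp H. \<bar>r * halpha H \<omega>\<bar> + \<bar>r * hbeta H \<omega>\<bar>)"
    unfolding hsize_def hscale_simps
    by (rule sum.mono_neutral_right[OF finite_hverts[OF assms(1)]])
      (use hsupp_cases(2)[OF assms(2)] in \<open>auto simp: hsupp_def\<close>)
  also have "\<dots> = (\<Sum>\<omega>\<in>hsupp H. r)"
  proof (intro sum.cong refl)
    fix \<omega> assume "\<omega> \<in> hsupp H"
    then have half: "halpha H \<omega> = 1 / 2" "hbeta H \<omega> = 1 / 2" using hsupp_cases(1)[OF assms(2)] by blast+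
    show "\<bar>r * halpha H \<omega>\<bar> + \<bar>r * hbeta H \<omega>\<bar> = r" unfolding half using assms(3) by simp
  qed
  finally show ?thesis by simp
qed

lemma measurable_hproj: "\<omega> \<in> hverts H \<Longrightarrow> hproj H \<omega> \<in> measurable (hspace H M) (kspace H M)"
  unfolding hproj_def[abs_def] hspace_def kspace_def hverts_def
  by (intro measurable_restrict measurable_component_singleton) auto

text \<open>For an empty support, the norm of every function over a probability space would be 1, even
  that of the zero function, since \<open>1 / hsize H\<close> is then 0.\<close>
lemma hsupp_nonempty:
  assumes wf: "hgpair_wf H" and nm: "norming TYPE('a) H" and ty: "typeI H 1"
  shows "hsupp H \<noteq> {}"
proof
  assume empty: "hsupp H = {}"
  \<comment> \<open>A point mass is a probability measure that exists on every type, so the norming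
    hypothesis at 'a applies to it. Homogeneity with the scalar 0 then yields 1 = 0.\<close>
  let ?M = "return (count_space UNIV) (undefined :: 'a)"
  have M: "prob_space ?M" by (rule prob_space_return) simp
  interpret P: prob_space "hspace H ?M"
    unfolding hspace_def by (rule prob_space_PiM) (rule M)
  have hp: "hpow H f = (\<lambda>_. 1)" for f :: "(nat \<Rightarrow> 'a) \<Rightarrow> complex"
    by (rule ext) (use hpow_hscale[OF wf ty, of 1 f] empty in simp)
  have nn: "hnorm H ?M f = 1" for f
    unfolding hnorm_def by (simp add: hp P.prob_space)
  have "(\<lambda>_. 0) \<in> LH H ?M"
    by (auto simp: LH_def hp P.emeasure_space_1)
  moreover have "hnorm_on H ?M" using nm by (simp add: norming_def)
  ultimately have "hnorm H ?M (\<lambda>x. 0 * (0::complex)) = cmod 0 * hnorm H ?M (\<lambda>_. 0)"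
    using hnorm_on_def[of H ?M, THEN iffD1, THEN conjunct2, THEN conjunct2, THEN conjunct1, rule_format]
    by blast
  then show False by (simp add: nn)
qed

context
  fixes H :: "'v hgpair" and M :: "'a measure"
  assumes wf: "hgpair_wf H" and nm: "norming TYPE('a) H" and ty: "typeI H 1"
begin

lemma tensor_forms_hgpair: "tensor_forms (hspace H M) (kspace H M) (hsupp H) (hproj H)"
proof
  show "finite (hsupp H)" using finite_hverts[OF wf] by (simp add: hsupp_def)
  show "hsupp H \<noteq> {}" by (rule hsupp_nonempty[OF wf nm ty])
  show "hproj H \<omega> \<in> measurable (hspace H M) (kspace H M)" if "\<omega> \<in> hsupp H" for \<omega>
    using that by (intro measurable_hproj) (simp add: hsupp_def)
qed

interpretation tensor_forms "hspace H M" "kspace H M" "hsupp H" "hproj H"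
  by (rule tensor_forms_hgpair)

lemma LH_hscale:
  assumes "0 < r"
  shows "LH (hscale r H) M = Lsp r"
proof -
  have "(\<integral>\<^sup>+ x. ennreal (cmod (hpow (hscale r H) (\<lambda>y. complex_of_real (cmod (f y))) x)) \<partial>hspace H M) < \<infinity>
      \<longleftrightarrow> integrable (hspace H M) (tensor (\<lambda>y. cmod (f y) powr r))"
    if f: "f \<in> borel_measurable (kspace H M)" for f
  proof -
    have eq: "cmod (hpow (hscale r H) (\<lambda>y. complex_of_real (cmod (f y))) x) = norm (tensor (\<lambda>y. cmod (f y) powr r) x)" for x
      using assms by (simp add: hpow_hscale[OF wf ty] tensor_def del: of_real_prod)
    have "(\<lambda>y. cmod (f y) powr r) \<in> borel_measurable (kspace H M)" using f by measurable
    then show ?thesis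
      unfolding eq integrable_iff_bounded using measurable_tensor by blast
  qed
  then show ?thesis by (auto simp: LH_def Lsp_def)
qed

lemma hnorm_hscale:
  assumes "0 < r"
  shows "hnorm (hscale r H) M f = nrm r f"
proof -
  have "hpow (hscale r H) f = (\<lambda>x. of_real (tensor (\<lambda>y. cmod (f y) powr r) x))"
    using hpow_hscale[OF wf ty, of r f] assms by (auto simp: tensor_def)
  then have "Re (integral\<^sup>L (hspace H M) (hpow (hscale r H) f)) = integral\<^sup>L (hspace H M) (tensor (\<lambda>y. cmod (f y) powr r))"
    by simp
  then show ?thesis
    unfolding hnorm_def nrm_def gauge_def hscale_simps
    using hsize_hscale[OF wf ty, of r] assms by (simp add: powr_powr mult.commute)
qed

text \<open>The case r = 1, in the direction needed to transport the norming hypothesis, stated for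
  complex functions in L_H, to nonnegative real functions.\<close>

lemma cone_iff_LH: "g \<in> cone \<longleftrightarrow> (\<forall>y. 0 \<le> g y) \<and> (\<lambda>y. complex_of_real (g y)) \<in> LH H M"
proof -
  have "g \<in> borel_measurable (kspace H M)" if "(\<lambda>y. complex_of_real (g y)) \<in> borel_measurable (kspace H M)"
  proof -
    have "(\<lambda>y. Re (complex_of_real (g y))) \<in> borel_measurable (kspace H M)" using that by measurable
    then show ?thesis by simp
  qed
  moreover have "(\<lambda>y. complex_of_real (g y)) \<in> borel_measurable (kspace H M)" if "g \<in> borel_measurable (kspace H M)"
    using that by measurable
  moreover have "LH H M = Lsp 1" using LH_hscale[of 1] by simp
  ultimately show ?thesis unfolding cone_def Lsp_def by fastforce
qed

lemma gauge_eq_hnorm: "(\<And>y. 0 \<le> g y) \<Longrightarrow> gauge g = hnorm H M (\<lambda>y. complex_of_real (g y))"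
  using hnorm_hscale[of 1] by (simp add: nrm_def)

lemma tensor_norm_hgpair: "tensor_norm (hspace H M) (kspace H M) (hsupp H) (hproj H)"
proof unfold_locales
  fix g h assume gh: "g \<in> cone" "h \<in> cone"
  have on: "hnorm_on H M" using nm by (simp add: norming_def)
  have LH: "(\<lambda>y. complex_of_real (g y)) \<in> LH H M" "(\<lambda>y. complex_of_real (h y)) \<in> LH H M"
    using gh by (simp_all add: cone_iff_LH)
  have "(\<lambda>y. complex_of_real (g y) + complex_of_real (h y)) \<in> LH H M"
    "hnorm H M (\<lambda>y. complex_of_real (g y) + complex_of_real (h y))
      \<le> hnorm H M (\<lambda>y. complex_of_real (g y)) + hnorm H M (\<lambda>y. complex_of_real (h y))"
    using on[unfolded hnorm_on_def, THEN conjunct2, THEN conjunct1, rule_format, OF LH] by auto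
  then show "(\<lambda>y. g y + h y) \<in> cone" "gauge (\<lambda>y. g y + h y) \<le> gauge g + gauge h"
    using coneD(2)[OF gh(1)] coneD(2)[OF gh(2)] by (simp_all add: cone_iff_LH gauge_eq_hnorm)
qed

end

theorem theorem3p9:
  fixes M :: "'a measure" and H :: "'v hgpair" and p0 p1 p \<theta> :: real
  assumes "hgpair_wf H"
    and "norming TYPE('a) H"
    and "typeI H 1"
    and "1 \<le> p0" and "1 \<le> p1"
    and "0 \<le> \<theta>" and "\<theta> \<le> 1"
    and "1 / p = (1 - \<theta>) / p0 + \<theta> / p1"
  shows "interp_space (LH (hscale p0 H) M) (hnorm (hscale p0 H) M)
                      (LH (hscale p1 H) M) (hnorm (hscale p1 H) M) \<theta> = LH (hscale p H) M
     \<and> (\<forall>f\<in>LH (hscale p H) M.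
          interp_norm (LH (hscale p0 H) M) (hnorm (hscale p0 H) M)
                      (LH (hscale p1 H) M) (hnorm (hscale p1 H) M) \<theta> f = hnorm (hscale p H) M f)"
proof -
  interpret tensor_norm "hspace H M" "kspace H M" "hsupp H" "hproj H"
    by (rule tensor_norm_hgpair[OF assms(1-3)])
  interpret interpolation "hspace H M" "kspace H M" "hsupp H" "hproj H" p0 p1 p \<theta>
    by unfold_locales (use assms in auto)
  have LH: "LH (hscale r H) M = Lsp r" and hnorm: "hnorm (hscale r H) M = nrm r" if "0 < r" for r
    using LH_hscale[OF assms(1-3) that] hnorm_hscale[OF assms(1-3) that] by (auto simp: fun_eq_iff)
  show ?thesis
    unfolding LH[OF pp(1)] LH[OF pp(2)] LH[OF p_pos] hnorm[OF pp(1)] hnorm[OF pp(2)] hnorm[OF p_pos]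
    using interp_space_eq interp_norm_eq by blast
qed

end
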